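(* For every positive integer $n$, there exists a type-$1,2$ $\mathrm{LRPA}(n)$, i.e. an $n\times n$ latin square on the symbol set $\{1,\ldots,n\}$ which is simultaneously a type-$1$ and a type-$2$ $\mathrm{RPA}(n)$.
   Context: Let $[n]=\{1,\ldots,n\}$. A retransmission permutation array of order $n$ ($\mathrm{RPA}(n)$) of type $1$ is an $n\times n$ array with entries from $[n]$ such that (i) every row is a permutation of $[n]$, and (ii) for each $1\le i\le n$, the $i\times\lceil n/i\rceil$ rectangle (rows $1,\dots,i$, columns $1,\dots,\lceil n/i\rceil$) in the upper left corner contains all $n$ symbols. Type $2$ is defined identically except that (ii) is required for the $i\times\lceil n/i\rceil$ rectangles in the upper right corner (rows $1,\dots,i$, the last $\lceil n/i\rceil$ columns). An $\mathrm{RPA}(n)$ is called latin ($\mathrm{LRPA}(n)$) if additionally every column is a permutation of $[n]$, i.e. the array is a latin square. *)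

theory Defs
  imports Complex_Main
begin

text \<open>
  An \<open>n \<times> n\<close> array is a function of the row and column index, both counted from 1;
  its values outside \<open>{1..n} \<times> {1..n}\<close> are irrelevant.
\<close>

type_synonym array = "nat \<Rightarrow> nat \<Rightarrow> nat"

definition rows_perm :: "nat \<Rightarrow> array \<Rightarrow> bool" where
  "rows_perm n A \<longleftrightarrow> (\<forall>r\<in>{1..n}. bij_betw (\<lambda>c. A r c) {1..n} {1..n})"

definition cols_perm :: "nat \<Rightarrow> array \<Rightarrow> bool" where
  "cols_perm n A \<longleftrightarrow> (\<forall>c\<in>{1..n}. bij_betw (\<lambda>r. A r c) {1..n} {1..n})"

definition latin_square :: "nat \<Rightarrow> array \<Rightarrow> bool" where
  "latin_square n A \<longleftrightarrow> rows_perm n A \<and> cols_perm n A"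

definition symbols_in :: "array \<Rightarrow> nat set \<Rightarrow> nat set \<Rightarrow> nat set" where
  "symbols_in A R C = {A r c |r c. r \<in> R \<and> c \<in> C}"

definition rect_width :: "nat \<Rightarrow> nat \<Rightarrow> nat" where
  "rect_width n i = nat \<lceil>real n / real i\<rceil>"

definition rpa_type1 :: "nat \<Rightarrow> array \<Rightarrow> bool" where
  "rpa_type1 n A \<longleftrightarrow>
     rows_perm n A \<and>
     (\<forall>i\<in>{1..n}. {1..n} \<subseteq> symbols_in A {1..i} {1..rect_width n i})"

text \<open>
  For \<open>1 \<le> i \<le> n\<close> the width is between 1 and \<open>n\<close>, so the subtraction below never truncates.
\<close>

definition rpa_type2 :: "nat \<Rightarrow> array \<Rightarrow> bool" where
  "rpa_type2 n A \<longleftrightarrow>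
     rows_perm n A \<and>
     (\<forall>i\<in>{1..n}. {1..n} \<subseteq> symbols_in A {1..i} {n - rect_width n i + 1..n})"

definition lrpa_type12 :: "nat \<Rightarrow> array \<Rightarrow> bool" where
  "lrpa_type12 n A \<longleftrightarrow> latin_square n A \<and> rpa_type1 n A \<and> rpa_type2 n A"

end

theory Submission
  imports Defs
begin

text \<open>
  Call the rectangle of height \<open>i\<close> and width \<open>\<lceil>n / i\<rceil>\<close> in a corner the \<open>i\<close>-th rectangle of that corner.
  The two corners are filled from bottom to top. Going up, one keeps for each corner an assignment of
  symbols to columns that leaves open in which of the rows \<open>1, \<dots>, m\<close> they go, each column holding exactly
  \<open>m\<close> symbols. When the \<open>m\<close>-th rectangle is reached, all unassigned symbols are put into its new
  columns; then row \<open>m\<close> picks one symbol from each column, and the picked symbols become unassigned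
  (or top up a new column). As a symbol is in at most one column per corner and each column has at
  least two symbols, Hall's theorem makes all picks of both corners distinct. So the row conflict between
  the two corners, which obstructs a top-down construction, disappears in this order.

  In the resulting partial array the filled cells of each column are its topmost ones, so the rows up to
  \<open>\<lceil>n / 2\<rceil>\<close> can be completed from top to bottom by an Ore type condition for perfect matchings; since a
  symbol outside row \<open>i\<close> already occurs in both \<open>i\<close>-th rectangles, the condition reads
  \<open>i + \<lceil>n / i\<rceil> \<le> n / 2 + 2\<close>. The remaining rows only have to extend a latin rectangle. The orders
  \<open>n < 8\<close> are given by tables.
\<close>

section \<open>Systems of distinct representatives\<close>

text \<open>Halmos-Vaughan induction on the size of the index set. If a nonempty proper subfamily
  \<open>J\<close> is tight, it is matched first and its union is deleted from the other sets;
  Hall's condition survives since it holds for every \<open>X \<union> J\<close>. Otherwise all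
  nonempty proper subfamilies have a surplus, so one representative may be fixed
  arbitrarily.\<close>

lemma hall_marriage:
  fixes A :: "'i \<Rightarrow> 'a set"
  assumes "finite I" "\<And>i. i \<in> I \<Longrightarrow> finite (A i)"
    and "\<And>J. J \<subseteq> I \<Longrightarrow> card J \<le> card (\<Union>i\<in>J. A i)"
  shows "\<exists>f. inj_on f I \<and> (\<forall>i\<in>I. f i \<in> A i)"
  using assms
proof (induction "card I" arbitrary: I A rule: less_induct)
  case less
  note fin = less.prems(1,2) and H = less.prems(3)
  show ?case
  proof (cases "\<exists>J. J \<subset> I \<and> J \<noteq> {} \<and> card (\<Union>i\<in>J. A i) = card J")
    case True
    then obtain J where J: "J \<subset> I" "J \<noteq> {}" "card (\<Union>i\<in>J. A i) = card J" by blast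
    define U where "U = (\<Union>i\<in>J. A i)"
    have finJ: "finite J" using J fin by (auto intro: finite_subset)
    have finU: "finite U"
      unfolding U_def by (rule finite_UN_I[OF finJ]) (use J fin(2) in auto)
    have "card J < card I" by (rule psubset_card_mono[OF fin(1) J(1)])
    then have "\<exists>f. inj_on f J \<and> (\<forall>i\<in>J. f i \<in> A i)"
      by (rule less.hyps) (use finJ fin H J in auto)
    then obtain f where f: "inj_on f J" "\<forall>i\<in>J. f i \<in> A i" by blast
    have "I - J \<subset> I" using J by blast
    then have "card (I - J) < card I" by (rule psubset_card_mono[OF fin(1)])
    moreover have "card X \<le> card (\<Union>i\<in>X. A i - U)" if X: "X \<subseteq> I - J" for X
    proof -
      have fX: "finite X" using X fin(1) by (meson finite_Diff finite_subset)
      have fXA: "finite (\<Union>i\<in>X. A i - U)" by (rule finite_UN_I[OF fX]) (use X fin(2) in auto)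
      have "card X + card J = card (X \<union> J)"
        using X fX finJ by (subst card_Un_disjoint) auto
      also have "\<dots> \<le> card (\<Union>i\<in>X \<union> J. A i)" by (rule H) (use X J in auto)
      also have "(\<Union>i\<in>X \<union> J. A i) = (\<Union>i\<in>X. A i - U) \<union> U" unfolding U_def by auto
      also have "card \<dots> = card (\<Union>i\<in>X. A i - U) + card U"
        by (rule card_Un_disjoint) (use fXA finU in auto)
      finally show ?thesis using J(3) unfolding U_def by simp
    qed
    ultimately have "\<exists>g. inj_on g (I - J) \<and> (\<forall>i\<in>I - J. g i \<in> A i - U)"
      using less.hyps[of "I - J" "\<lambda>i. A i - U"] fin by auto
    then obtain g where g: "inj_on g (I - J)" "\<forall>i\<in>I - J. g i \<in> A i - U" by blast
    define h where "h i = (if i \<in> J then f i else g i)" for i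
    have fU: "f i \<in> U" if "i \<in> J" for i using f that unfolding U_def by auto
    have gU: "g i \<notin> U" if "i \<in> I - J" for i using g(2) that by blast
    have "inj_on h I"
    proof (rule inj_onI)
      fix i j assume ij: "i \<in> I" "j \<in> I" "h i = h j"
      show "i = j"
      proof (cases "i \<in> J \<longleftrightarrow> j \<in> J")
        case True
        then show ?thesis
          using ij f(1) g(1) by (cases "i \<in> J") (auto simp: h_def inj_on_def)
      next
        case False
        then show ?thesis
          using ij gU[of i] gU[of j] fU[of i] fU[of j] by (cases "i \<in> J") (auto simp: h_def)
      qed
    qed
    moreover have "\<forall>i\<in>I. h i \<in> A i" using f g unfolding h_def by auto
    ultimately show ?thesis by blast
  next
    case False
    show ?thesis
    proof (cases "I = {}")
      case True
      then show ?thesis by simp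
    next
      case ne: False
      then obtain k where k: "k \<in> I" by blast
      have "card {k} \<le> card (\<Union>i\<in>{k}. A i)" by (rule H) (use k in auto)
      then obtain x where x: "x \<in> A k" by fastforce
      have "card (I - {k}) < card I" using k fin by (meson card_Diff1_less)
      moreover have "card X \<le> card (\<Union>i\<in>X. A i - {x})" if X: "X \<subseteq> I - {k}" for X
      proof (cases "X = {}")
        case nX: False
        have "X \<subset> I" using X k by auto
        then have "card (\<Union>i\<in>X. A i) \<noteq> card X" using False nX by blast
        then have "card X < card (\<Union>i\<in>X. A i)"
          using H[of X] \<open>X \<subset> I\<close> by (simp add: order_less_le psubset_imp_subset)
        moreover have "(\<Union>i\<in>X. A i - {x}) = (\<Union>i\<in>X. A i) - {x}" by auto
        ultimately show ?thesis
          using diff_card_le_card_Diff[of "{x}" "\<Union>i\<in>X. A i"] by simp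
      qed simp
      ultimately have "\<exists>g. inj_on g (I - {k}) \<and> (\<forall>i\<in>I - {k}. g i \<in> A i - {x})"
        using less.hyps[of "I - {k}" "\<lambda>i. A i - {x}"] fin by auto
      then obtain g where g: "inj_on g (I - {k})" "\<forall>i\<in>I - {k}. g i \<in> A i - {x}" by blast
      have "inj_on (g(k := x)) I"
        using g unfolding inj_on_def by (auto simp: fun_upd_def)
      moreover have "\<forall>i\<in>I. (g(k := x)) i \<in> A i" using g x by auto
      ultimately show ?thesis by blast
    qed
  qed
qed

text \<open>Each element of the union \<open>U\<close> is counted at most \<open>d\<close> times in
  the sum of sizes, so that sum is at most \<open>d * card U\<close>, which forces
  \<open>card J - 1 < card U\<close>. The strict inequality leaves slack: sets of size
  \<open>d\<close> may lose fewer than \<open>d\<close> elements in total.\<close>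

lemma sdr_of_bounded_degree:
  fixes A :: "'i \<Rightarrow> 'a set"
  assumes "finite I" "\<And>i. i \<in> I \<Longrightarrow> finite (A i)"
    and deg: "\<And>x. card {i \<in> I. x \<in> A i} \<le> d"
    and big: "\<And>J. J \<subseteq> I \<Longrightarrow> J \<noteq> {} \<Longrightarrow> d * (card J - 1) < (\<Sum>i\<in>J. card (A i))"
  shows "\<exists>f. inj_on f I \<and> (\<forall>i\<in>I. f i \<in> A i)"
proof (rule hall_marriage)
  fix J assume J: "J \<subseteq> I"
  show "card J \<le> card (\<Union>i\<in>J. A i)"
  proof (cases "J = {}")
    case False
    have fJ: "finite J" using J assms(1) by (rule finite_subset)
    define U where "U = (\<Union>i\<in>J. A i)"
    have fU: "finite U" 
      unfolding U_def by (rule finite_UN_I[OF fJ]) (use J assms(2) in auto)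
    have "d * (card J - 1) < (\<Sum>i\<in>J. card (A i))" by (rule big[OF J False])
    also have "\<dots> = (\<Sum>i\<in>J. \<Sum>x\<in>U. if x \<in> A i then 1 else 0)"
    proof (rule sum.cong[OF refl])
      fix i assume "i \<in> J"
      then have "U \<inter> {x. x \<in> A i} = A i" unfolding U_def by auto
      then show "card (A i) = (\<Sum>x\<in>U. if x \<in> A i then 1 else 0)"
        using fU by (simp add: sum.If_cases)
    qed
    also have "\<dots> = (\<Sum>x\<in>U. \<Sum>i\<in>J. if x \<in> A i then 1 else 0)" by (rule sum.swap)
    also have "\<dots> = (\<Sum>x\<in>U. card {i \<in> J. x \<in> A i})"
      using fJ by (simp add: sum.If_cases Int_def)
    also have "\<dots> \<le> (\<Sum>x\<in>U. d)"
    proof (rule sum_mono)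
      fix x
      have "card {i \<in> J. x \<in> A i} \<le> card {i \<in> I. x \<in> A i}"
        by (rule card_mono) (use J assms(1) in auto)
      then show "card {i \<in> J. x \<in> A i} \<le> d" using deg[of x] by simp
    qed
    also have "\<dots> = d * card U" by simp
    finally have "card J - 1 < card U" by simp
    then show ?thesis unfolding U_def by simp
  qed simp
qed (use assms in auto)

text \<open>If \<open>J\<close> violates Hall's condition, some \<open>x\<close> of \<open>S\<close>
  lies outside its union \<open>U\<close>. For \<open>c\<close> in \<open>J\<close> the set
  \<open>N c\<close> is inside \<open>U\<close>, and the indices admitting \<open>x\<close> are
  inside \<open>F - J\<close>, so the two sizes add up to less than \<open>card S\<close>, against
  \<open>ore\<close> for the pair \<open>c\<close>, \<open>x\<close>.\<close>

lemma perfect_matching_of_ore: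
  fixes N :: "'i \<Rightarrow> 'a set"
  assumes fin: "finite F" "finite S" and sub: "\<And>c. c \<in> F \<Longrightarrow> N c \<subseteq> S"
    and card: "card F = card S"
    and ore: "\<And>c x. c \<in> F \<Longrightarrow> x \<in> S \<Longrightarrow> x \<notin> N c \<Longrightarrow>
       card S \<le> card (N c) + card {c' \<in> F. x \<in> N c'}"
  shows "\<exists>f. inj_on f F \<and> (\<forall>c\<in>F. f c \<in> N c)"
proof (rule hall_marriage)
  fix J assume J: "J \<subseteq> F"
  define U where "U = (\<Union>c\<in>J. N c)"
  have US: "U \<subseteq> S" unfolding U_def using J sub by blast
  have finJ: "finite J" using J fin by (auto intro: finite_subset)
  have finU: "finite U" using US fin by (auto intro: finite_subset)
  have "card J \<le> card U"
  proof (rule ccontr)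
    assume less: "\<not> card J \<le> card U"
    then have "U \<noteq> S" using card J card_mono[OF fin(1) J] by auto
    then obtain x where x: "x \<in> S" "x \<notin> U" using US by blast
    have "J \<noteq> {}" using less by auto
    then obtain c where c: "c \<in> J" by blast
    have "x \<notin> N c" using x c unfolding U_def by auto
    then have "card S \<le> card (N c) + card {c' \<in> F. x \<in> N c'}" using ore c J x by blast
    also have "card (N c) \<le> card U"
      by (rule card_mono[OF finU]) (use c in \<open>auto simp: U_def\<close>)
    also have "card {c' \<in> F. x \<in> N c'} \<le> card (F - J)"
      by (rule card_mono) (use fin x in \<open>auto simp: U_def\<close>)
    also have "card (F - J) = card S - card J" using J finJ card by (simp add: card_Diff_subset)
    finally show False using less card card_mono[OF fin(1) J] by simp
  qed
  then show "card J \<le> card (\<Union>c\<in>J. N c)" unfolding U_def .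
qed (use fin sub in \<open>auto intro: finite_subset\<close>)

section \<open>Latin rectangles\<close>

definition latin_rect :: "nat \<Rightarrow> nat \<Rightarrow> array \<Rightarrow> bool" where
  "latin_rect n m A \<longleftrightarrow>
     (\<forall>r\<in>{1..m}. bij_betw (A r) {1..n} {1..n}) \<and>
     (\<forall>c\<in>{1..n}. inj_on (\<lambda>r. A r c) {1..m})"

lemma latin_rect_add_row:
  assumes "latin_rect n m A" "bij_betw f {1..n} {1..n}"
    and "\<And>r c. r \<in> {1..m} \<Longrightarrow> c \<in> {1..n} \<Longrightarrow> f c \<noteq> A r c"
  shows "latin_rect n (Suc m) (A(Suc m := f))"
  unfolding latin_rect_def
proof (intro conjI ballI)
  fix r assume "r \<in> {1..Suc m}"
  then consider "r = Suc m" | "r \<in> {1..m}" "r \<noteq> Suc m" by force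
  then show "bij_betw ((A(Suc m := f)) r) {1..n} {1..n}"
  proof cases
    case 1
    then show ?thesis using assms(2) by simp
  next
    case 2
    then show ?thesis using assms(1) unfolding latin_rect_def fun_upd_other[OF 2(2)] by blast
  qed
next
  fix c assume c: "c \<in> {1..n}"
  have "inj_on (\<lambda>r. A r c) {1..m}" using assms(1) c by (simp add: latin_rect_def)
  moreover have eq: "(A(Suc m := f)) r c = A r c" if "r \<in> {1..m}" for r
    using that by simp
  ultimately have "inj_on (\<lambda>r. (A(Suc m := f)) r c) {1..m}"
    using inj_on_cong[of "{1..m}" "\<lambda>r. (A(Suc m := f)) r c" "\<lambda>r. A r c"] by blast
  moreover have "(A(Suc m := f)) (Suc m) c \<notin> (\<lambda>r. (A(Suc m := f)) r c) ` {1..m}"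
  proof
    assume "(A(Suc m := f)) (Suc m) c \<in> (\<lambda>r. (A(Suc m := f)) r c) ` {1..m}"
    then obtain r where "r \<in> {1..m}" "f c = A r c" using eq by auto
    then show False using assms(3)[OF _ c] by blast
  qed
  ultimately show "inj_on (\<lambda>r. (A(Suc m := f)) r c) {1..Suc m}"
    by (simp add: atLeastAtMostSuc_conv)
qed

text \<open>The symbol occurs once in each of the \<open>m\<close> rows, and these occurrences are
  in distinct columns.\<close>

lemma latin_rect_symbol_columns:
  assumes A: "latin_rect n m A" and x: "x \<in> {1..n}"
  shows "card {c \<in> {1..n}. x \<in> (\<lambda>r. A r c) ` {1..m}} = m"
proof -
  define h where "h r = inv_into {1..n} (A r) x" for r
  have h: "h r \<in> {1..n}" "A r (h r) = x" if "r \<in> {1..m}" for r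
  proof -
    have "x \<in> A r ` {1..n}"
      using A x that by (simp add: latin_rect_def bij_betw_def)
    then show "h r \<in> {1..n}" "A r (h r) = x"
      unfolding h_def by (rule inv_into_into, rule f_inv_into_f)
  qed
  have hu: "c = h r" if "r \<in> {1..m}" "c \<in> {1..n}" "A r c = x" for r c
  proof -
    have "inj_on (A r) {1..n}" using A that(1) by (simp add: latin_rect_def bij_betw_def)
    then show ?thesis by (rule inj_onD) (use h[OF that(1)] that in auto)
  qed
  have "inj_on h {1..m}"
  proof (rule inj_onI)
    fix r r' assume r: "r \<in> {1..m}" "r' \<in> {1..m}" "h r = h r'"
    have "inj_on (\<lambda>r. A r (h r')) {1..m}" using A h(1)[OF r(2)] by (simp add: latin_rect_def)
    then show "r = r'"
      by (rule inj_onD) (use r h(2)[OF r(1)] h(2)[OF r(2)] in auto)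
  qed
  moreover have "h ` {1..m} = {c \<in> {1..n}. x \<in> (\<lambda>r. A r c) ` {1..m}}"
  proof (intro equalityI subsetI)
    fix c assume "c \<in> h ` {1..m}"
    then obtain r where r: "r \<in> {1..m}" "c = h r" by blast
    then have "A r c = x" "c \<in> {1..n}" using h by simp_all
    then show "c \<in> {c \<in> {1..n}. x \<in> (\<lambda>r. A r c) ` {1..m}}" using r(1) by blast
  next
    fix c assume "c \<in> {c \<in> {1..n}. x \<in> (\<lambda>r. A r c) ` {1..m}}"
    then obtain r where "r \<in> {1..m}" "c \<in> {1..n}" "A r c = x" by blast
    then show "c \<in> h ` {1..m}" using hu by blast
  qed
  ultimately show ?thesis using card_image[of h "{1..m}"] by simp
qed

lemma latin_rect_column_card:
  assumes A: "latin_rect n m A" and c: "c \<in> {1..n}"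
  shows "(\<lambda>r. A r c) ` {1..m} \<subseteq> {1..n}" "card ((\<lambda>r. A r c) ` {1..m}) = m"
proof -
  show "(\<lambda>r. A r c) ` {1..m} \<subseteq> {1..n}"
  proof
    fix x assume "x \<in> (\<lambda>r. A r c) ` {1..m}"
    then obtain r where "r \<in> {1..m}" "x = A r c" by blast
    then show "x \<in> {1..n}"
      using A c bij_betwE[of "A r" "{1..n}" "{1..n}"] by (auto simp: latin_rect_def)
  qed
  show "card ((\<lambda>r. A r c) ` {1..m}) = m"
    using A c by (subst card_image) (auto simp: latin_rect_def)
qed

lemma bij_betw_self_if_inj:
  fixes f :: "nat \<Rightarrow> nat"
  assumes "inj_on f {1..n}" "\<And>c. c \<in> {1..n} \<Longrightarrow> f c \<in> {1..n}"
  shows "bij_betw f {1..n} {1..n}"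
  unfolding bij_betw_def
  using assms by (metis endo_inj_surj finite_atLeastAtMost image_subsetI)

text \<open>Every column lacks \<open>n - m\<close> symbols and every symbol is missing from
  \<open>n - m\<close> columns. A matching in this regular bipartite graph is the next row.\<close>

lemma latin_rect_completes:
  assumes "latin_rect n m A" "m \<le> n"
  shows "\<exists>B. latin_rect n n B \<and> (\<forall>r\<in>{1..m}. B r = A r)"
  using assms
proof (induction "n - m" arbitrary: m A)
  case 0
  then show ?case by auto
next
  case (Suc k)
  then have mn: "m < n" by simp
  define N where "N c = {1..n} - (\<lambda>r. A r c) ` {1..m}" for c
  have cardN: "card (N c) = n - m" if "c \<in> {1..n}" for c
    using latin_rect_column_card[OF Suc.prems(1) that] unfolding N_def
    by (simp add: card_Diff_subset)
  have "\<exists>f. inj_on f {1..n} \<and> (\<forall>c\<in>{1..n}. f c \<in> N c)"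
  proof (rule sdr_of_bounded_degree[where d = "n - m"])
    fix x
    show "card {c \<in> {1..n}. x \<in> N c} \<le> n - m"
    proof (cases "x \<in> {1..n}")
      case True
      define D where "D = {c \<in> {1..n}. x \<in> (\<lambda>r. A r c) ` {1..m}}"
      have "{c \<in> {1..n}. x \<in> N c} = {1..n} - D"
        unfolding N_def D_def using True by auto
      moreover have "D \<subseteq> {1..n}" "finite D" unfolding D_def by auto
      moreover have "card D = m"
        unfolding D_def by (rule latin_rect_symbol_columns[OF Suc.prems(1) True])
      ultimately show ?thesis by (simp add: card_Diff_subset)
    qed (auto simp: N_def)
  next
    fix J assume J: "J \<subseteq> {1..n}" "J \<noteq> {}"
    have "finite J" using J(1) by (rule finite_subset) simp
    then have "0 < card J" using J(2) by (simp add: card_gt_0_iff)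
    moreover have "(\<Sum>c\<in>J. card (N c)) = (\<Sum>c\<in>J. n - m)"
      by (rule sum.cong[OF refl], rule cardN) (use J in auto)
    ultimately show "(n - m) * (card J - 1) < (\<Sum>c\<in>J. card (N c))"
      using mn by (simp add: mult.commute)
  qed (auto simp: N_def)
  then obtain f where f: "inj_on f {1..n}" "\<forall>c\<in>{1..n}. f c \<in> N c" by blast
  have L: "latin_rect n (Suc m) (A(Suc m := f))"
  proof (rule latin_rect_add_row[OF Suc.prems(1)])
    show "bij_betw f {1..n} {1..n}"
      by (rule bij_betw_self_if_inj[OF f(1)]) (use f(2) in \<open>auto simp: N_def\<close>)
    show "f c \<noteq> A r c" if "r \<in> {1..m}" "c \<in> {1..n}" for r c
      using f(2) that unfolding N_def by blast
  qed
  have "k = n - Suc m" "Suc m \<le> n" using Suc.hyps(2) mn by simp_all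
  then obtain B where B: "latin_rect n n B" "\<forall>r\<in>{1..Suc m}. B r = (A(Suc m := f)) r"
    using Suc.hyps(1)[OF _ L] by blast
  moreover have "B r = A r" if "r \<in> {1..m}" for r using B(2) that by simp
  ultimately show ?case by blast
qed

text \<open>An entry \<open>0\<close> of \<open>P\<close> stands for an empty cell.\<close>

lemma partial_rows_complete:
  fixes P :: array
  assumes le: "\<And>r c. P r c \<le> n"
    and rows: "\<And>r. r \<in> {1..m} \<Longrightarrow> inj_on (P r) {c \<in> {1..n}. P r c \<noteq> 0}"
    and cols: "\<And>r r' c. r \<in> {1..m} \<Longrightarrow> r' \<in> {1..<r} \<Longrightarrow> c \<in> {1..n} \<Longrightarrow> P r c \<noteq> 0 \<Longrightarrow>
      P r' c \<noteq> 0 \<and> P r' c \<noteq> P r c"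
    and room: "\<And>r x. r \<in> {1..m} \<Longrightarrow> x \<in> {1..n} \<Longrightarrow> x \<notin> P r ` {1..n} \<Longrightarrow>
      2 * r + card {c \<in> {1..n}. P r c \<noteq> 0 \<and> (\<forall>r'\<in>{1..<r}. P r' c \<noteq> x)} \<le> n + 2"
  shows "\<exists>A. latin_rect n m A \<and> (\<forall>r\<in>{1..m}. \<forall>c\<in>{1..n}. P r c \<noteq> 0 \<longrightarrow> A r c = P r c)"
  using rows cols room
proof (induction m)
  case 0
  then show ?case by (auto simp: latin_rect_def)
next
  case (Suc m)
  have "\<exists>A. latin_rect n m A \<and> (\<forall>r\<in>{1..m}. \<forall>c\<in>{1..n}. P r c \<noteq> 0 \<longrightarrow> A r c = P r c)"
  proof (rule Suc.IH)
    fix r assume "r \<in> {1..m}"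
    then have r: "r \<in> {1..Suc m}" by simp
    show "inj_on (P r) {c \<in> {1..n}. P r c \<noteq> 0}" by (rule Suc.prems(1)[OF r])
    show "P r' c \<noteq> 0 \<and> P r' c \<noteq> P r c" if "r' \<in> {1..<r}" "c \<in> {1..n}" "P r c \<noteq> 0" for r' c
      by (rule Suc.prems(2)[OF r that])
    show "2 * r + card {c \<in> {1..n}. P r c \<noteq> 0 \<and> (\<forall>r'\<in>{1..<r}. P r' c \<noteq> x)} \<le> n + 2"
      if "x \<in> {1..n}" "x \<notin> P r ` {1..n}" for x
      by (rule Suc.prems(3)[OF r that])
  qed
  then obtain A where A: "latin_rect n m A"
    and AP: "\<And>r c. r \<in> {1..m} \<Longrightarrow> c \<in> {1..n} \<Longrightarrow> P r c \<noteq> 0 \<Longrightarrow> A r c = P r c" by blast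
  note colsS = Suc.prems(2)[of "Suc m"] and roomS = Suc.prems(3)[of "Suc m"]
  \<comment> \<open>The new row consists of the prescribed cells \<open>C\<close> and a perfect
    matching of the free cells \<open>F\<close> with the remaining symbols \<open>S\<close>;
    \<open>N c\<close> keeps the symbols not yet used in column \<open>c\<close>.\<close>
  define C where "C = {c \<in> {1..n}. P (Suc m) c \<noteq> 0}"
  define F where "F = {1..n} - C"
  define S where "S = {1..n} - P (Suc m) ` C"
  define up where "up c = (\<lambda>r. A r c) ` {1..m}" for c
  define N where "N c = S - up c" for c
  have finC: "finite C" and Csub: "C \<subseteq> {1..n}" by (auto simp: C_def)
  have finup: "finite (up c)" for c by (simp add: up_def)
  have injC: "inj_on (P (Suc m)) C" unfolding C_def by (rule Suc.prems(1)) simp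
  have PC: "P (Suc m) ` C \<subseteq> {1..n}" using le unfolding C_def by (auto simp: Suc_le_eq)
  have cF: "card F = n - card C" unfolding F_def using Csub by (simp add: card_Diff_subset finC)
  have cS: "card S = n - card C" unfolding S_def
    using PC injC by (simp add: card_Diff_subset finC card_image)
  have Cn: "card C \<le> n" using card_mono[OF _ Csub] by simp
  \<comment> \<open>All cells above a prescribed cell are prescribed too, so these entries do not
    depend on how the earlier rows were completed. This is why the room condition can be stated in
    terms of \<open>P\<close> alone.\<close>
  have upP: "A r c = P r c" if "c \<in> C" "r \<in> {1..m}" for r c
    using AP[OF that(2)] colsS[of r c] that by (auto simp: C_def)
  have "\<exists>f. inj_on f F \<and> (\<forall>c\<in>F. f c \<in> N c)"
  proof (rule perfect_matching_of_ore)
    fix c x assume c: "c \<in> F" and x: "x \<in> S"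
    have x1: "x \<in> {1..n}" using x by (simp add: S_def)
    have xP: "x \<notin> P (Suc m) ` {1..n}" using x by (auto simp: S_def C_def)
    define Q where "Q = {c \<in> {1..n}. x \<in> up c}"
    define Z where "Z = {c \<in> C. x \<notin> up c}"
    have N: "card S - m \<le> card (N c)"
    proof -
      have "card (up c) = m"
        unfolding up_def using latin_rect_column_card(2)[OF A, of c] c by (auto simp: F_def)
      then show ?thesis unfolding N_def using diff_card_le_card_Diff[OF finup[of c], of S] by simp
    qed
    have d: "card {c' \<in> F. x \<in> N c'} = card F - card (Q - C)"
    proof -
      have "{c' \<in> F. x \<in> N c'} = F - (Q - C)"
        unfolding N_def Q_def F_def using x by auto
      moreover have "Q - C \<subseteq> F" unfolding Q_def F_def by auto
      ultimately show ?thesis by (simp add: card_Diff_subset finite_subset F_def)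
    qed
    have Q: "card Q = m"
      unfolding Q_def up_def by (rule latin_rect_symbol_columns[OF A x1])
    have Q2: "card Q = card (Q - C) + card (Q \<inter> C)"
    proof -
      have "card ((Q - C) \<union> (Q \<inter> C)) = card (Q - C) + card (Q \<inter> C)"
        by (rule card_Un_disjoint) (auto simp: Q_def)
      moreover have "(Q - C) \<union> (Q \<inter> C) = Q" by blast
      ultimately show ?thesis by simp
    qed
    have Z: "card C = card Z + card (Q \<inter> C)"
    proof -
      have "card (Z \<union> (Q \<inter> C)) = card Z + card (Q \<inter> C)"
        by (rule card_Un_disjoint) (auto simp: Q_def Z_def finC)
      moreover have "Z \<union> (Q \<inter> C) = C" using Csub unfolding Z_def Q_def by blast
      ultimately show ?thesis by simp
    qed
    \<comment> \<open>Since \<open>card (Q - C) = m + card Z - card C\<close>, the inequality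
      \<open>m + card (Q - C) \<le> card S\<close>, from which the Ore condition follows, says
      exactly this.\<close>
    have room: "2 * m + card Z \<le> n"
    proof -
      have "Z = {c \<in> {1..n}. P (Suc m) c \<noteq> 0 \<and> (\<forall>r'\<in>{1..<Suc m}. P r' c \<noteq> x)}"
        using upP unfolding Z_def up_def C_def by (force simp: image_iff)
      then show ?thesis using roomS[of x] x1 xP by simp
    qed
    have "m + card (Q - C) \<le> card S" using Q Q2 Z room cS Cn by linarith
    then show "card S \<le> card (N c) + card {c' \<in> F. x \<in> N c'}"
      using N d cF cS by linarith
  next
    show "card F = card S" by (simp add: cF cS)
  qed (simp_all add: F_def S_def N_def)
  then obtain f where f: "inj_on f F" "\<And>c. c \<in> F \<Longrightarrow> f c \<in> N c" by blast
  define g where "g c = (if c \<in> C then P (Suc m) c else f c)" for c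
  have fS: "f c \<in> S" "f c \<notin> up c" if "c \<in> F" for c using f(2)[OF that] by (auto simp: N_def)
  have "latin_rect n (Suc m) (A(Suc m := g))"
  proof (rule latin_rect_add_row[OF A])
    show "bij_betw g {1..n} {1..n}"
    proof (rule bij_betw_self_if_inj)
      show "inj_on g {1..n}"
      proof (rule inj_onI)
        fix c c' assume cc: "c \<in> {1..n}" "c' \<in> {1..n}" "g c = g c'"
        consider "c \<in> C" "c' \<in> C" | "c \<in> F" "c' \<in> F" | "c \<in> C" "c' \<in> F" | "c \<in> F" "c' \<in> C"
          using cc by (auto simp: F_def)
        then show "c = c'"
        proof cases
          case 1 then show ?thesis using cc injC by (auto simp: g_def inj_on_def)
        next
          case 2 then show ?thesis using cc f(1) by (auto simp: g_def inj_on_def F_def)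
        next
          case 3
          then have "f c' = P (Suc m) c" using cc by (auto simp: g_def F_def)
          then have "f c' \<in> P (Suc m) ` C" using 3 by simp
          then show ?thesis using fS(1)[of c'] 3 by (auto simp: S_def)
        next
          case 4
          then have "f c = P (Suc m) c'" using cc by (auto simp: g_def F_def)
          then have "f c \<in> P (Suc m) ` C" using 4 by simp
          then show ?thesis using fS(1)[of c] 4 by (auto simp: S_def)
        qed
      qed
      show "g c \<in> {1..n}" if "c \<in> {1..n}" for c
        using that PC fS(1)[of c] by (auto simp: g_def F_def S_def)
    qed
    show "g c \<noteq> A r c" if rc: "r \<in> {1..m}" "c \<in> {1..n}" for r c
    proof (cases "c \<in> C")
      case True
      then show ?thesis using colsS[of r c] upP[OF True rc(1)] rc by (auto simp: g_def C_def)
    next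
      case False
      then show ?thesis using fS(2)[of c] rc by (auto simp: g_def F_def up_def)
    qed
  qed
  moreover have "\<forall>r\<in>{1..Suc m}. \<forall>c\<in>{1..n}. P r c \<noteq> 0 \<longrightarrow> (A(Suc m := g)) r c = P r c"
    using AP by (auto simp: g_def C_def)
  ultimately show ?case by blast
qed

section \<open>Assignments of symbols to columns\<close>

definition load :: "nat \<Rightarrow> (nat \<Rightarrow> nat) \<Rightarrow> nat \<Rightarrow> nat set" where
  "load n lam c = {x \<in> {1..n}. lam x = c}"

text \<open>An assignment sends each symbol to one of the first \<open>v\<close> columns of a corner, or to \<open>0\<close> if
  the symbol is unassigned. In the top right corner, column \<open>c\<close> means the column \<open>n + 1 - c\<close> of
  the array.\<close>

definition balanced :: "nat \<Rightarrow> nat \<Rightarrow> nat \<Rightarrow> (nat \<Rightarrow> nat) \<Rightarrow> bool" where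
  "balanced n m v lam \<longleftrightarrow>
     (\<forall>x\<in>{1..n}. lam x \<le> v) \<and> (\<forall>c\<in>{1..v}. card (load n lam c) = m)"

lemma finite_load [simp]: "finite (load n lam c)"
  by (simp add: load_def)

lemma card_unassigned:
  assumes "balanced n m v lam"
  shows "card (load n lam 0) + m * v = n"
proof -
  have "{1..n} = (\<Union>c\<in>{0..v}. load n lam c)"
    using assms by (auto simp: balanced_def load_def)
  then have "n = card (\<Union>c\<in>{0..v}. load n lam c)"
    by (metis card_atLeastAtMost diff_Suc_1)
  also have "\<dots> = (\<Sum>c\<in>{0..v}. card (load n lam c))"
    by (rule card_UN_disjoint) (auto simp: load_def)
  also have "\<dots> = card (load n lam 0) + (\<Sum>c\<in>{1..v}. card (load n lam c))"
    by (simp add: sum.atLeast_Suc_atMost)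
  also have "(\<Sum>c\<in>{1..v}. card (load n lam c)) = (\<Sum>c\<in>{1..v}. m)"
    by (rule sum.cong[OF refl]) (use assms in \<open>simp add: balanced_def\<close>)
  finally show ?thesis by (simp add: mult.commute)
qed

text \<open>A numbering that starts at a distinguished element lets \<open>extend_assignment\<close>
  steer \<open>z\<close> into the first new column.\<close>

lemma bij_betw_nat_from_zero:
  assumes "finite U"
  shows "\<exists>h. bij_betw h U {0..<card U} \<and> (z \<in> U \<longrightarrow> h z = (0::nat))"
proof (cases "z \<in> U")
  case True
  have "finite (U - {z})" using assms by simp
  then obtain g where g: "bij_betw g (U - {z}) {0..<card (U - {z})}"
    using ex_bij_betw_finite_nat by blast
  define h where "h x = (if x = z then 0 else Suc (g x))" for x
  have c: "card U = Suc (card (U - {z}))" using card_Suc_Diff1[OF assms True] by simp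
  have "inj_on h U"
    using g by (auto simp: inj_on_def bij_betw_def h_def)
  moreover have "h ` U = {0..<card U}"
  proof -
    have "h ` U = insert 0 (Suc ` g ` (U - {z}))"
      using True by (auto simp: h_def image_iff)
    also have "g ` (U - {z}) = {0..<card (U - {z})}" using g by (simp add: bij_betw_def)
    also have "insert 0 (Suc ` {0..<card (U - {z})}) = {0..<card U}"
      unfolding c by (auto simp: image_Suc_atLeastLessThan)
    finally show ?thesis .
  qed
  ultimately show ?thesis unfolding bij_betw_def by (intro exI[of _ h]) (simp add: h_def)
next
  case False
  then show ?thesis using ex_bij_betw_finite_nat[OF assms] by blast
qed

lemma card_div_class:
  assumes "0 < (m::nat)"
  shows "card {k \<in> {0..<N}. k div m = j} = min m (N - m * j)"
proof -
  have "{k \<in> {0..<N}. k div m = j} = {m * j..<min N (m * j + m)}"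
  proof (intro equalityI subsetI)
    fix k assume k: "k \<in> {k \<in> {0..<N}. k div m = j}"
    then have "k = m * j + k mod m" using mult_div_mod_eq[of m k] by simp
    moreover have "k mod m < m" using assms by simp
    ultimately have "m * j \<le> k" "k < m * j + m" by linarith+
    then show "k \<in> {m * j..<min N (m * j + m)}" using k by simp
  next
    fix k assume k: "k \<in> {m * j..<min N (m * j + m)}"
    then have "k div m = j" by (intro div_nat_eqI) (auto simp: mult.commute)
    then show "k \<in> {k \<in> {0..<N}. k div m = j}" using k by simp
  qed
  then have "card {k \<in> {0..<N}. k div m = j} = min N (m * j + m) - m * j"
    by (simp only: card_atLeastLessThan)
  then show ?thesis by linarith
qed

text \<open>Only the last of the new columns may receive fewer than \<open>m\<close> symbols. The parameter \<open>z\<close> is a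
  symbol that is to be kept out of that column, when there is another new one.\<close>

lemma extend_assignment:
  assumes bal: "balanced n m v lam" and m: "0 < m" and v: "v < v'"
    and low: "m * (v' - 1) < n" and high: "n \<le> m * v'"
  shows "\<exists>lam'. (\<forall>x\<in>{1..n}. lam' x \<in> {1..v'}) \<and>
    (\<forall>c\<in>{1..v}. load n lam' c = load n lam c) \<and>
    (\<forall>c\<in>{1..v' - 1}. card (load n lam' c) = m) \<and>
    card (load n lam' v') = n - m * (v' - 1) \<and>
    (z \<in> load n lam 0 \<longrightarrow> lam' z = v + 1)"
proof -
  define U where "U = load n lam 0"
  have cU: "card U + m * v = n" unfolding U_def by (rule card_unassigned[OF bal])
  obtain h where h: "bij_betw h U {0..<card U}" "z \<in> U \<longrightarrow> h z = 0"
    using bij_betw_nat_from_zero[of U z] by (auto simp: U_def)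
  \<comment> \<open>The unassigned symbols are cut into blocks of length \<open>m\<close> along the
    numbering \<open>h\<close>, one block per new column. As \<open>z\<close> has number 0, it lands
    in column \<open>v + 1\<close>.\<close>
  define lam' where "lam' x = (if x \<in> U then v + 1 + h x div m else lam x)" for x
  have old: "load n lam' c = load n lam c" if "c \<in> {1..v}" for c
    using that by (auto simp: load_def lam'_def U_def)
  have le: "lam x \<le> v" if "x \<in> {1..n}" for x using bal that by (simp add: balanced_def)
  have new: "card (load n lam' (v + 1 + j)) = min m (card U - m * j)" for j
  proof -
    have "load n lam' (v + 1 + j) = {x \<in> U. h x div m = j}"
    proof (intro equalityI subsetI)
      fix x assume x: "x \<in> load n lam' (v + 1 + j)"
      then have "x \<in> U" using le[of x] by (auto simp: load_def lam'_def split: if_splits)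
      then show "x \<in> {x \<in> U. h x div m = j}" using x by (simp add: load_def lam'_def)
    next
      fix x assume "x \<in> {x \<in> U. h x div m = j}"
      then show "x \<in> load n lam' (v + 1 + j)" by (simp add: load_def lam'_def U_def)
    qed
    moreover have "h ` {x \<in> U. h x div m = j} = {k \<in> {0..<card U}. k div m = j}"
    proof -
      have "h ` {x \<in> U. h x div m = j} = {k \<in> h ` U. k div m = j}" by blast
      then show ?thesis unfolding bij_betw_imp_surj_on[OF h(1)] .
    qed
    moreover have "inj_on h {x \<in> U. h x div m = j}"
      by (rule inj_on_subset[OF bij_betw_imp_inj_on[OF h(1)]]) blast
    ultimately have "card (load n lam' (v + 1 + j)) = card {k \<in> {0..<card U}. k div m = j}"
      using card_image[of h "{x \<in> U. h x div m = j}"] by simp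
    then show ?thesis using card_div_class[OF m] by simp
  qed
  \<comment> \<open>\<open>D\<close> counts the new columns before the last one. There are between
    \<open>m * D + 1\<close> and \<open>m * D + m\<close> unassigned symbols, so the first
    \<open>D\<close> blocks are full and the last one is nonempty.\<close>
  define D where "D = v' - 1 - v"
  have v': "v' = v + 1 + D" using v by (simp add: D_def)
  have cUD: "m * D < card U" "card U \<le> m * D + m"
    using cU low high unfolding v' by (simp_all add: algebra_simps)
  show ?thesis
  proof (intro exI[of _ lam'] conjI ballI impI)
    fix x assume x: "x \<in> {1..n}"
    show "lam' x \<in> {1..v'}"
    proof (cases "x \<in> U")
      case True
      have "h x < card U" using h(1) True bij_betwE by fastforce
      then have "h x < (D + 1) * m" using cUD by (simp add: algebra_simps)
      then have "h x div m < D + 1" using m by (simp add: div_less_iff_less_mult)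
      then show ?thesis using True by (simp add: lam'_def v')
    next
      case False
      then have "lam x \<noteq> 0" using x by (simp add: U_def load_def)
      then show ?thesis using False le[OF x] v by (simp add: lam'_def)
    qed
  next
    fix c assume c: "c \<in> {1..v' - 1}"
    show "card (load n lam' c) = m"
    proof (cases "c \<le> v")
      case True
      then show ?thesis using old[of c] c bal by (simp add: balanced_def)
    next
      case False
      define j where "j = c - (v + 1)"
      have j: "c = v + 1 + j" "j + 1 \<le> D" using False c v by (auto simp: j_def D_def)
      have "m * (j + 1) \<le> m * D" using j(2) by (rule mult_le_mono2)
      then have "m \<le> card U - m * j" using cUD by (simp add: algebra_simps)
      then show ?thesis using new[of j] j by simp
    qed
  next
    show "card (load n lam' v') = n - m * (v' - 1)"
    proof -
      have "m * (v' - 1) = m * v + m * D" by (simp add: v' algebra_simps)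
      then have "min m (card U - m * D) = n - m * (v' - 1)" using cUD cU by linarith
      then show ?thesis using new[of D] by (simp add: v')
    qed
  next
    assume "z \<in> load n lam 0"
    then show "lam' z = v + 1" using h(2) by (simp add: lam'_def U_def)
  qed (rule old)
qed

text \<open>All picks of both corners form one system of distinct representatives. A symbol is in at
  most one left and one right column, so its degree is at most 2, while the columns have at least
  two symbols. Excluding \<open>a\<close> shrinks only one right column, by one symbol, which the
  slack of \<open>sdr_of_bounded_degree\<close> absorbs.\<close>

lemma pick_representatives:
  assumes m: "2 \<le> m"
    and L: "\<And>c. c \<in> {1..f} \<Longrightarrow> card (load n lam c) = m"
    and R: "\<And>c. c \<in> {1..f} \<Longrightarrow> card (load n rho c) = m"
  shows "\<exists>p q. (\<forall>c\<in>{1..f}. p c \<in> load n lam c) \<and> (\<forall>c\<in>{1..f}. q c \<in> load n rho c - {a}) \<and>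
    (\<forall>c\<in>{1..f}. \<forall>d\<in>{1..f}. p c \<noteq> q d)"
proof -
  define I where "I = (UNIV :: bool set) \<times> {1..f}"
  define A where "A = (\<lambda>(s, c). if s then load n lam c else load n rho c - {a})"
  have "\<exists>F. inj_on F I \<and> (\<forall>i\<in>I. F i \<in> A i)"
  proof (rule sdr_of_bounded_degree[where d = 2])
    fix x
    have "{i \<in> I. x \<in> A i} \<subseteq> {(True, lam x), (False, rho x)}"
      by (auto simp: A_def load_def split: if_splits)
    then have "card {i \<in> I. x \<in> A i} \<le> card {(True, lam x), (False, rho x)}"
      by (rule card_mono[rotated]) simp
    then show "card {i \<in> I. x \<in> A i} \<le> 2" by simp
  next
    fix J assume J: "J \<subseteq> I" "J \<noteq> {}"
    have fJ: "finite J" using J(1) by (rule finite_subset) (simp add: I_def)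
    \<comment> \<open>The correction term charges the loss of \<open>a\<close> to its unique right
      column \<open>rho a\<close>.\<close>
    have "2 \<le> card (A i) + (if i = (False, rho a) then 1 else 0)" if "i \<in> J" for i
    proof -
      obtain s c where i: "i = (s, c)" by (cases i)
      have c: "c \<in> {1..f}" using that J(1) unfolding i I_def by blast
      show ?thesis
      proof (cases "\<not> s \<and> a \<in> load n rho c")
        case True
        then show ?thesis using i R[OF c] m by (simp add: A_def load_def)
      next
        case False
        then show ?thesis using i L[OF c] R[OF c] m by (auto simp: A_def)
      qed
    qed
    then have "(\<Sum>i\<in>J. 2) \<le> (\<Sum>i\<in>J. card (A i) + (if i = (False, rho a) then 1 else 0))"
      by (rule sum_mono)
    also have "\<dots> \<le> (\<Sum>i\<in>J. card (A i)) + 1" using fJ by (simp add: sum.distrib)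
    finally have "2 * card J \<le> (\<Sum>i\<in>J. card (A i)) + 1" by simp
    moreover have "0 < card J" using J(2) fJ by (simp add: card_gt_0_iff)
    ultimately show "2 * (card J - 1) < (\<Sum>i\<in>J. card (A i))" by linarith
  qed (auto simp: I_def A_def)
  then obtain F where F: "inj_on F I" "\<And>i. i \<in> I \<Longrightarrow> F i \<in> A i" by blast
  show ?thesis
  proof (rule exI[of _ "\<lambda>c. F (True, c)"], rule exI[of _ "\<lambda>c. F (False, c)"], intro conjI ballI)
    fix c assume "c \<in> {1..f}"
    then show "F (True, c) \<in> load n lam c" "F (False, c) \<in> load n rho c - {a}"
      using F(2)[of "(True, c)"] F(2)[of "(False, c)"] by (auto simp: I_def A_def)
  next
    fix c d assume "c \<in> {1..f}" "d \<in> {1..f}"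
    then show "F (True, c) \<noteq> F (False, d)"
      using inj_onD[OF F(1), of "(True, c)" "(False, d)"] by (auto simp: I_def)
  qed
qed

text \<open>If the last column has fewer than \<open>m\<close> symbols, nothing is picked from it, and it is topped up with
  picks from other columns. These symbols have just been placed in row \<open>m\<close> and were never in the last
  column, so no column repeats a symbol.\<close>

lemma reassign_picks:
  assumes le: "\<And>x. x \<in> {1..n} \<Longrightarrow> lam x \<le> v"
    and f: "f \<le> v" "v \<le> f + 1" and d: "d \<le> f"
    and full: "\<And>c. c \<in> {1..f} \<Longrightarrow> card (load n lam c) = m"
    and part: "f < v \<Longrightarrow> card (load n lam v) + d = m - 1"
    and p: "\<And>c. c \<in> {1..f} \<Longrightarrow> p c \<in> load n lam c"
  shows "\<exists>lam'. balanced n (m - 1) v lam' \<and>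
    (\<forall>c\<in>{1..f}. load n lam' c = load n lam c - {p c}) \<and>
    (f < v \<longrightarrow> load n lam v \<subseteq> load n lam' v)"
proof -
  define X where "X = p ` {1..f}"
  have lp: "lam (p c) = c" "p c \<in> {1..n}" if "c \<in> {1..f}" for c
    using p[OF that] by (auto simp: load_def)
  have "inj_on p {1..f}" by (rule inj_on_inverseI[of _ lam]) (rule lp)
  then have "card X = f" by (simp add: X_def card_image)
  then obtain T0 where T0: "T0 \<subseteq> X" "card T0 = d"
    using d obtain_subset_with_card_n[of d X] by metis
  define T where "T = (if f < v then T0 else {})"
  have T: "T \<subseteq> X" "f < v \<Longrightarrow> card T = d" using T0 by (auto simp: T_def)
  \<comment> \<open>Picked symbols become unassigned, except for those in \<open>T\<close>, which
    supply the \<open>d\<close> symbols that a partly filled last column still lacks.\<close>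
  define lam' where "lam' x = (if x \<in> X then if x \<in> T then v else 0 else lam x)" for x
  have X: "x \<in> X \<longleftrightarrow> x = p c" if "c \<in> {1..f}" "lam x = c" for x c
    using that lp by (auto simp: X_def)
  have old: "load n lam' c = load n lam c - {p c}" if c: "c \<in> {1..f}" for c
  proof (intro equalityI subsetI)
    fix x assume x: "x \<in> load n lam' c"
    have "x \<notin> T"
    proof
      assume xT: "x \<in> T"
      then have "x \<in> X" "f < v" using T(1) by (auto simp: T_def split: if_splits)
      then show False using x c xT by (simp add: load_def lam'_def)
    qed
    then have "x \<notin> X" "lam x = c" "x \<in> {1..n}"
      using x c by (auto simp: load_def lam'_def split: if_splits)
    then show "x \<in> load n lam c - {p c}" using X[OF c] by (auto simp: load_def)
  next
    fix x assume x: "x \<in> load n lam c - {p c}"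
    then have "lam x = c" "x \<in> {1..n}" by (auto simp: load_def)
    moreover from this have "x \<notin> X" using X[OF c] x by blast
    ultimately show "x \<in> load n lam' c" by (simp add: load_def lam'_def)
  qed
  have new: "load n lam' v = load n lam v \<union> T" "load n lam v \<inter> T = {}" if v: "f < v"
  proof -
    have disj: "x \<notin> X" if "lam x = v" for x
      using that lp(1) v by (auto simp: X_def)
    have "T \<subseteq> {1..n}" using T(1) lp(2) by (auto simp: X_def)
    then show "load n lam' v = load n lam v \<union> T"
      using disj T(1) v by (auto simp: load_def lam'_def split: if_splits)
    show "load n lam v \<inter> T = {}" using disj T(1) by (auto simp: load_def)
  qed
  have "finite T" using T(1) by (rule finite_subset) (simp add: X_def)
  have "balanced n (m - 1) v lam'"
    unfolding balanced_def
  proof (intro conjI ballI)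
    show "lam' x \<le> v" if "x \<in> {1..n}" for x using le[OF that] by (simp add: lam'_def)
    fix c assume c: "c \<in> {1..v}"
    show "card (load n lam' c) = m - 1"
    proof (cases "c \<le> f")
      case True
      then show ?thesis using old[of c] full[of c] p[of c] c by simp
    next
      case False
      then have "c = v" "f < v" using c f by auto
      then show ?thesis using new part T(2) \<open>finite T\<close> by (simp add: card_Un_disjoint)
    qed
  qed
  then show ?thesis using old new by blast
qed

section \<open>Filling two corners\<close>

text \<open>For positive \<open>n\<close> this is the ceiling of \<open>n / i\<close> in natural
  number arithmetic; \<open>rect_width_eq_row_width\<close> makes the link.\<close>

definition row_width :: "nat \<Rightarrow> nat \<Rightarrow> nat" where
  "row_width n i = (n - 1) div i + 1"

text \<open>The number of columns, on each side, in which row \<open>m\<close> is prescribed at most. The second term of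
  the minimum makes it skip the heights whose rectangle contains one of smaller height and the same
  width.\<close>

definition cut_width :: "nat \<Rightarrow> nat \<Rightarrow> nat" where
  "cut_width n m = min (row_width n m) ((n - 1) div (m - 1))"

text \<open>Zero marks an empty cell. The third clause makes the filled cells of a column its
  topmost ones. Coverage starts at height 2 because height 1 is automatic in a latin rectangle. The
  last two clauses serve the room condition of \<open>partial_rows_complete\<close>: few prescribed
  cells from row 3 on, and rows 1 and 2 so full that no symbol is missing from them.\<close>

definition corner_plan ::
  "nat \<Rightarrow> nat \<Rightarrow> nat \<Rightarrow> (nat \<Rightarrow> nat) \<Rightarrow> (nat \<Rightarrow> nat) \<Rightarrow> array \<Rightarrow> bool" where
  "corner_plan n m v lam rho P \<longleftrightarrow>
     (\<forall>r c. P r c \<le> n) \<and>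
     (\<forall>r\<in>{1..m}. inj_on (P r) {c \<in> {1..n}. P r c \<noteq> 0}) \<and>
     (\<forall>r\<in>{1..m}. \<forall>r'\<in>{1..<r}. \<forall>c\<in>{1..n}. P r c \<noteq> 0 \<longrightarrow> P r' c \<noteq> 0 \<and> P r' c \<noteq> P r c) \<and>
     (\<forall>c\<in>{1..v}. (\<lambda>r. P r c) ` {1..m} = load n lam c \<and>
        (\<lambda>r. P r (n + 1 - c)) ` {1..m} = load n rho c) \<and>
     (\<forall>i\<in>{2..m}. \<forall>x\<in>{1..n}.
        (\<exists>r\<in>{1..i}. \<exists>c\<in>{1..row_width n i}. P r c = x) \<and>
        (\<exists>r\<in>{1..i}. \<exists>c\<in>{1..row_width n i}. P r (n + 1 - c) = x)) \<and>
     (\<forall>r\<in>{3..m}. \<forall>c\<in>{1..n}. P r c \<noteq> 0 \<longrightarrow> c \<le> cut_width n r \<or> n + 1 - c \<le> cut_width n r) \<and>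
     (\<forall>r\<in>{1, 2}. \<forall>c\<in>{1..n}. P r c \<noteq> 0)"

text \<open>Quantifying over all assignments turns the filling from bottom to top into an induction
  on the height: whatever the lower rows leave to the top \<open>m\<close> rows can be realised
  there.\<close>

definition plannable :: "nat \<Rightarrow> nat \<Rightarrow> nat \<Rightarrow> bool" where
  "plannable n m v \<longleftrightarrow>
     (\<forall>lam rho. balanced n m v lam \<and> balanced n m v rho \<longrightarrow> (\<exists>P. corner_plan n m v lam rho P))"

lemma corner_planD:
  assumes "corner_plan n m v lam rho P"
  shows "P r c \<le> n"
    and "r \<in> {1..m} \<Longrightarrow> inj_on (P r) {c \<in> {1..n}. P r c \<noteq> 0}"
    and "r \<in> {1..m} \<Longrightarrow> r' \<in> {1..<r} \<Longrightarrow> c \<in> {1..n} \<Longrightarrow> P r c \<noteq> 0 \<Longrightarrow>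
      P r' c \<noteq> 0 \<and> P r' c \<noteq> P r c"
    and "c \<in> {1..v} \<Longrightarrow> (\<lambda>r. P r c) ` {1..m} = load n lam c"
    and "c \<in> {1..v} \<Longrightarrow> (\<lambda>r. P r (n + 1 - c)) ` {1..m} = load n rho c"
    and "i \<in> {2..m} \<Longrightarrow> x \<in> {1..n} \<Longrightarrow> \<exists>r\<in>{1..i}. \<exists>c\<in>{1..row_width n i}. P r c = x"
    and "i \<in> {2..m} \<Longrightarrow> x \<in> {1..n} \<Longrightarrow> \<exists>r\<in>{1..i}. \<exists>c\<in>{1..row_width n i}. P r (n + 1 - c) = x"
    and "r \<in> {3..m} \<Longrightarrow> c \<in> {1..n} \<Longrightarrow> P r c \<noteq> 0 \<Longrightarrow>
      c \<le> cut_width n r \<or> n + 1 - c \<le> cut_width n r"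
    and "r \<in> {1, 2} \<Longrightarrow> c \<in> {1..n} \<Longrightarrow> P r c \<noteq> 0"
proof -
  note D1 = assms[unfolded corner_plan_def]
  note D2 = D1[THEN conjunct2] note D3 = D2[THEN conjunct2] note D4 = D3[THEN conjunct2]
  note D5 = D4[THEN conjunct2] note D6 = D5[THEN conjunct2] note D7 = D6[THEN conjunct2]
  show "P r c \<le> n" by (rule D1[THEN conjunct1, rule_format])
  show "inj_on (P r) {c \<in> {1..n}. P r c \<noteq> 0}" if "r \<in> {1..m}"
    by (rule D2[THEN conjunct1, rule_format, OF that])
  show "P r' c \<noteq> 0 \<and> P r' c \<noteq> P r c"
    if "r \<in> {1..m}" "r' \<in> {1..<r}" "c \<in> {1..n}" "P r c \<noteq> 0"
    using D3[THEN conjunct1] that by blast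
  show "(\<lambda>r. P r c) ` {1..m} = load n lam c" if "c \<in> {1..v}"
    by (rule D4[THEN conjunct1, THEN bspec, OF that, THEN conjunct1])
  show "(\<lambda>r. P r (n + 1 - c)) ` {1..m} = load n rho c" if "c \<in> {1..v}"
    by (rule D4[THEN conjunct1, THEN bspec, OF that, THEN conjunct2])
  show "\<exists>r\<in>{1..i}. \<exists>c\<in>{1..row_width n i}. P r c = x" if "i \<in> {2..m}" "x \<in> {1..n}"
    by (rule D5[THEN conjunct1, THEN bspec, OF that(1), THEN bspec, OF that(2), THEN conjunct1])
  show "\<exists>r\<in>{1..i}. \<exists>c\<in>{1..row_width n i}. P r (n + 1 - c) = x" if "i \<in> {2..m}" "x \<in> {1..n}"
    by (rule D5[THEN conjunct1, THEN bspec, OF that(1), THEN bspec, OF that(2), THEN conjunct2])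
  show "c \<le> cut_width n r \<or> n + 1 - c \<le> cut_width n r"
    if "r \<in> {3..m}" "c \<in> {1..n}" "P r c \<noteq> 0"
    using D6[THEN conjunct1] that by blast
  show "P r c \<noteq> 0" if "r \<in> {1, 2}" "c \<in> {1..n}" using D7 that by blast
qed

text \<open>Here \<open>lamE\<close> and \<open>rhoE\<close> are the assignments after new columns
  are opened, \<open>lam'\<close> and \<open>rho'\<close> those after the picks for row
  \<open>m\<close> are removed. A column up to \<open>f\<close> holds its reduced load in the rows
  above, so its pick is new there and restores the full load. Coverage at height \<open>m\<close> is
  inherited from \<open>m - 1\<close> if the width is unchanged; otherwise every symbol is assigned
  to one of the columns of the rectangle.\<close>

lemma add_row_to_plan:
  assumes P': "corner_plan n (m - 1) v' lam' rho' P'"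
    and m: "3 \<le> m" and v': "v' = cut_width n m" "2 * v' \<le> n"
    and vf: "v \<le> f" "f \<le> v'" "v' \<le> f + 1"
    and old: "\<And>c. c \<in> {1..v} \<Longrightarrow> load n lamE c = load n lam c"
      "\<And>c. c \<in> {1..v} \<Longrightarrow> load n rhoE c = load n rho c"
    and p: "\<And>c. c \<in> {1..f} \<Longrightarrow> p c \<in> load n lamE c" "\<And>c. c \<in> {1..f} \<Longrightarrow> q c \<in> load n rhoE c"
    and pq: "\<And>c d. c \<in> {1..f} \<Longrightarrow> d \<in> {1..f} \<Longrightarrow> p c \<noteq> q d"
    and lam': "\<And>c. c \<in> {1..f} \<Longrightarrow> load n lam' c = load n lamE c - {p c}"
      "f < v' \<Longrightarrow> load n lamE v' \<subseteq> load n lam' v'"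
    and rho': "\<And>c. c \<in> {1..f} \<Longrightarrow> load n rho' c = load n rhoE c - {q c}"
      "f < v' \<Longrightarrow> load n rhoE v' \<subseteq> load n rho' v'"
    and cov: "row_width n (m - 1) = row_width n m \<or>
      v' = row_width n m \<and> (\<forall>x\<in>{1..n}. lamE x \<in> {1..v'} \<and> rhoE x \<in> {1..v'})"
  shows "\<exists>P. corner_plan n m v lam rho P"
proof -
  note le' = corner_planD(1)[OF P'] and rows' = corner_planD(2)[OF P']
    and cols' = corner_planD(3)[OF P'] and setL' = corner_planD(4)[OF P']
    and setR' = corner_planD(5)[OF P'] and covL' = corner_planD(6)[OF P']
    and covR' = corner_planD(7)[OF P'] and dom' = corner_planD(8)[OF P']
    and full' = corner_planD(9)[OF P']
  have lp: "lamE (p c) = c" "p c \<in> {1..n}" if "c \<in> {1..f}" for c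
    using p(1)[OF that] by (auto simp: load_def)
  have lq: "rhoE (q c) = c" "q c \<in> {1..n}" if "c \<in> {1..f}" for c
    using p(2)[OF that] by (auto simp: load_def)
  \<comment> \<open>As \<open>f \<le> v'\<close> and \<open>2 * v' \<le> n\<close>, the left and the
    right columns are disjoint.\<close>
  define g where "g c = (if c \<in> {1..f} then p c else if c \<le> n \<and> n + 1 - c \<in> {1..f} then q (n + 1 - c) else 0)" for c
  define P where "P = P'(m := g)"
  have Pm: "P m = g" and Pr: "\<And>r. r < m \<Longrightarrow> P r = P' r" by (simp_all add: P_def)
  have gL: "g c = p c" if "c \<in> {1..f}" for c using that by (simp add: g_def)
  have gR: "g (n + 1 - c) = q c" if "c \<in> {1..f}" for c
    using that vf v' by (auto simp: g_def)
  have gE: "(c \<in> {1..f} \<and> g c = p c) \<or> (n + 1 - c \<in> {1..f} \<and> c \<le> n \<and> g c = q (n + 1 - c))"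
    if "g c \<noteq> 0" for c
    using that by (auto simp: g_def split: if_splits)
  have img: "(\<lambda>r. P r c) ` {1..m} = insert (g c) ((\<lambda>r. P' r c) ` {1..m - 1})" for c
  proof -
    have "{1..m} = insert m {1..m - 1}" using m by auto
    then have "(\<lambda>r. P r c) ` {1..m} = insert (P m c) ((\<lambda>r. P r c) ` {1..m - 1})" by simp
    also have "(\<lambda>r. P r c) ` {1..m - 1} = (\<lambda>r. P' r c) ` {1..m - 1}"
      by (rule image_cong[OF refl]) (use Pr m in auto)
    finally show ?thesis by (simp add: Pm)
  qed
  have setL: "(\<lambda>r. P r c) ` {1..m} = load n lamE c" if "c \<in> {1..f}" for c
    using img[of c] setL'[of c] lam'(1)[OF that] gL[OF that] p(1)[OF that] that vf by auto
  have setR: "(\<lambda>r. P r (n + 1 - c)) ` {1..m} = load n rhoE c" if "c \<in> {1..f}" for c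
    using img[of "n + 1 - c"] setR'[of c] rho'(1)[OF that] gR[OF that] p(2)[OF that] that vf by auto
  have "corner_plan n m v lam rho P"
    unfolding corner_plan_def
  proof (intro conjI allI ballI impI)
    fix r c
    show "P r c \<le> n"
    proof (cases "r = m \<and> g c \<noteq> 0")
      case True
      then have "P r c = g c" "g c \<noteq> 0" using Pm by auto
      moreover from gE[OF this(2)] have "g c \<in> {1..n}"
        by (elim disjE conjE) (simp_all only: lp(2) lq(2))
      ultimately show ?thesis by simp
    next
      case False
      then show ?thesis using le'[of r c] by (auto simp: P_def)
    qed
  next
    fix r assume r: "r \<in> {1..m}"
    show "inj_on (P r) {c \<in> {1..n}. P r c \<noteq> 0}"
    proof (cases "r = m")
      case True
      show ?thesis unfolding True Pm
      proof (rule inj_onI)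
        fix c d assume c: "c \<in> {c \<in> {1..n}. g c \<noteq> 0}" and d: "d \<in> {c \<in> {1..n}. g c \<noteq> 0}"
          and eq: "g c = g d"
        from c d have ne: "g c \<noteq> 0" "g d \<noteq> 0" by auto
        from gE[OF ne(1)] gE[OF ne(2)] show "c = d"
        proof (elim disjE conjE)
          assume "c \<in> {1..f}" "g c = p c" "d \<in> {1..f}" "g d = p d"
          then show ?thesis using lp(1) eq by metis
        next
          assume "c \<in> {1..f}" "g c = p c" "n + 1 - d \<in> {1..f}" "g d = q (n + 1 - d)"
          then show ?thesis using pq eq by metis
        next
          assume "n + 1 - c \<in> {1..f}" "g c = q (n + 1 - c)" "d \<in> {1..f}" "g d = p d"
          then show ?thesis using pq eq by metis
        next
          assume "n + 1 - c \<in> {1..f}" "g c = q (n + 1 - c)" "c \<le> n"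
            "n + 1 - d \<in> {1..f}" "g d = q (n + 1 - d)" "d \<le> n"
          moreover from this have "n + 1 - c = n + 1 - d" using lq(1) eq by metis
          ultimately show ?thesis by linarith
        qed
      qed
    next
      case False
      then have "r \<in> {1..m - 1}" "r < m" using r by auto
      then show ?thesis using rows'[of r] Pr[of r] by simp
    qed
  next
    fix r r' c assume r: "r \<in> {1..m}" "r' \<in> {1..<r}" "c \<in> {1..n}" "P r c \<noteq> 0"
    have "P r' c \<noteq> 0 \<and> P r' c \<noteq> P r c"
    proof (cases "r = m")
      case True
      then have r': "r' \<in> {1..m - 1}" "P r' c = P' r' c" using r Pr[of r'] by auto
      have "g c \<noteq> 0" using r(4) True Pm by simp
      from gE[OF this] show ?thesis
      proof (elim disjE conjE)
        assume c: "c \<in> {1..f}" "g c = p c"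
        have "P' r' c \<in> load n lam' c" using setL'[of c] r'(1) c(1) vf by auto
        then have "P' r' c \<in> load n lamE c - {p c}" using lam'(1)[OF c(1)] by simp
        then show ?thesis using r'(2) True Pm c(2) by (auto simp: load_def)
      next
        assume c: "n + 1 - c \<in> {1..f}" "g c = q (n + 1 - c)" "c \<le> n"
        have "n + 1 - (n + 1 - c) = c" using c(3) by simp
        then have "P' r' c \<in> load n rho' (n + 1 - c)"
          using setR'[of "n + 1 - c"] r'(1) c(1) vf by force
        then have "P' r' c \<in> load n rhoE (n + 1 - c) - {q (n + 1 - c)}"
          using rho'(1)[OF c(1)] by simp
        then show ?thesis using r'(2) True Pm c(2) by (auto simp: load_def)
      qed
    next
      case False
      then have "r \<in> {1..m - 1}" "r < m" "r' < m" using r by auto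
      then show ?thesis using cols'[of r r' c] r Pr[of r] Pr[of r'] by simp
    qed
    then show "P r' c \<noteq> 0" "P r' c \<noteq> P r c" by blast+
  next
    fix c assume c: "c \<in> {1..v}"
    then have "c \<in> {1..f}" using vf by auto
    then show "(\<lambda>r. P r c) ` {1..m} = load n lam c" "(\<lambda>r. P r (n + 1 - c)) ` {1..m} = load n rho c"
      using setL setR old[OF c] by simp_all
  next
    fix i x assume i: "i \<in> {2..m}" and x: "x \<in> {1..n}"
    have "(\<exists>r\<in>{1..i}. \<exists>c\<in>{1..row_width n i}. P r c = x) \<and>
      (\<exists>r\<in>{1..i}. \<exists>c\<in>{1..row_width n i}. P r (n + 1 - c) = x)"
    proof (cases "i = m \<and> row_width n (m - 1) \<noteq> row_width n m")
      case True
      then have w: "v' = row_width n m" and E: "lamE x \<in> {1..v'}" "rhoE x \<in> {1..v'}"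
        using cov x by auto
      have "x \<in> (\<lambda>r. P r (lamE x)) ` {1..m}"
      proof (cases "lamE x \<le> f")
        case True
        then show ?thesis using setL[of "lamE x"] E x by (simp add: load_def)
      next
        case False
        \<comment> \<open>Nothing is picked from the partly filled last column; its symbols survive
          in \<open>lam'\<close> and so occur above row \<open>m\<close>.\<close>
        then have "lamE x = v'" "f < v'" using E vf by auto
        then have "x \<in> load n lam' (lamE x)" using lam'(2) x by (auto simp: load_def)
        then show ?thesis using img[of "lamE x"] setL'[OF E(1)] by simp
      qed
      moreover have "x \<in> (\<lambda>r. P r (n + 1 - rhoE x)) ` {1..m}"
      proof (cases "rhoE x \<le> f")
        case True
        then show ?thesis using setR[of "rhoE x"] E x by (simp add: load_def)
      next
        case False
        then have "rhoE x = v'" "f < v'" using E vf by auto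
        then have "x \<in> load n rho' (rhoE x)" using rho'(2) x by (auto simp: load_def)
        then show ?thesis using img[of "n + 1 - rhoE x"] setR'[OF E(2)] by simp
      qed
      ultimately obtain r s where r: "r \<in> {1..m}" "P r (lamE x) = x"
        and s: "s \<in> {1..m}" "P s (n + 1 - rhoE x) = x" by (elim imageE) metis
      have "\<exists>r\<in>{1..m}. \<exists>c\<in>{1..v'}. P r c = x" using r E(1) by blast
      moreover have "\<exists>r\<in>{1..m}. \<exists>c\<in>{1..v'}. P r (n + 1 - c) = x" using s E(2) by blast
      ultimately show ?thesis using True unfolding w by simp
    next
      case False
      \<comment> \<open>If \<open>i = m\<close> and the width is unchanged, the rectangle of height
        \<open>m - 1\<close> is contained in this one and already has all symbols.\<close>
      define i' where "i' = (if i = m then m - 1 else i)"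
      have i': "i' \<in> {2..m - 1}" "row_width n i' = row_width n i" "i' \<le> i" "i' < m"
        using i m False by (auto simp: i'_def)
      have eq: "P r = P' r" "r \<in> {1..i}" if "r \<in> {1..i'}" for r
        using Pr[of r] that i'(3,4) by simp_all
      obtain r c where "r \<in> {1..i'}" "c \<in> {1..row_width n i}" "P' r c = x"
        using covL'[OF i'(1) x] unfolding i'(2) by blast
      then have L: "\<exists>r\<in>{1..i}. \<exists>c\<in>{1..row_width n i}. P r c = x"
        using eq by (intro bexI[of _ r] bexI[of _ c]) simp_all
      obtain r c where "r \<in> {1..i'}" "c \<in> {1..row_width n i}" "P' r (n + 1 - c) = x"
        using covR'[OF i'(1) x] unfolding i'(2) by blast
      then have "\<exists>r\<in>{1..i}. \<exists>c\<in>{1..row_width n i}. P r (n + 1 - c) = x"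
        using eq by (intro bexI[of _ r] bexI[of _ c]) simp_all
      with L show ?thesis ..
    qed
    then show "\<exists>r\<in>{1..i}. \<exists>c\<in>{1..row_width n i}. P r c = x"
      "\<exists>r\<in>{1..i}. \<exists>c\<in>{1..row_width n i}. P r (n + 1 - c) = x" by blast+
  next
    fix r c assume r: "r \<in> {3..m}" "c \<in> {1..n}" "P r c \<noteq> 0"
    show "c \<le> cut_width n r \<or> n + 1 - c \<le> cut_width n r"
    proof (cases "r = m")
      case True
      then show ?thesis using gE[of c] r Pm v' vf by auto
    next
      case False
      then show ?thesis using dom'[of r c] Pr[of r] r by auto
    qed
  next
    fix r :: nat and c assume "r \<in> {1, 2}" "c \<in> {1..n}"
    then show "P r c \<noteq> 0" using full'[of r c] Pr[of r] m by auto
  qed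
  then show ?thesis by blast
qed

text \<open>Either no column is opened, or the \<open>m\<close>-th rectangle is reached and all
  unassigned symbols enter new columns. \<open>f\<close> counts the columns from which row
  \<open>m\<close> picks. A short last column has \<open>n - m * (v' - 1)\<close> symbols and needs
  \<open>m - 1\<close> for the rows above, hence lacks \<open>m * v' - n - 1\<close>; this
  difference does not truncate when \<open>f < v'\<close>.\<close>

lemma extend_or_keep:
  assumes bal: "balanced n m v lam" and m: "0 < m" and v: "v \<le> v'"
    and new: "v' = v \<or> m * (v' - 1) < n \<and> n \<le> m * v'"
    and f: "f = (if v' = v \<or> n = m * v' then v' else v' - 1)"
  shows "\<exists>lam'. (\<forall>x\<in>{1..n}. lam' x \<le> v') \<and>
    (\<forall>c\<in>{1..v}. load n lam' c = load n lam c) \<and>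
    (\<forall>c\<in>{1..f}. card (load n lam' c) = m) \<and>
    (f < v' \<longrightarrow> card (load n lam' v') + (m * v' - n - 1) = m - 1) \<and>
    (n \<le> m * v' \<longrightarrow> (\<forall>x\<in>{1..n}. lam' x \<in> {1..v'}))"
proof (cases "v' = v")
  case True
  have le: "\<forall>x\<in>{1..n}. lam x \<le> v" and ca: "\<forall>c\<in>{1..v}. card (load n lam c) = m"
    using bal by (simp_all add: balanced_def)
  have "lam x \<noteq> 0" if "n \<le> m * v" "x \<in> {1..n}" for x
  proof -
    have "card (load n lam 0) = 0" using card_unassigned[OF bal] that(1) by linarith
    then have "x \<notin> load n lam 0" by (simp only: card_0_eq[OF finite_load]) simp
    then show ?thesis using that(2) by (simp add: load_def)
  qed
  then show ?thesis using True f le ca by (intro exI[of _ lam]) (auto simp: Suc_le_eq)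
next
  case False
  then have vv: "v < v'" and low: "m * (v' - 1) < n" and high: "n \<le> m * v'" using v new by auto
  from extend_assignment[OF bal m vv low high, of 0] obtain lam' where
    E: "\<forall>x\<in>{1..n}. lam' x \<in> {1..v'}" "\<forall>c\<in>{1..v}. load n lam' c = load n lam c"
    "\<forall>c\<in>{1..v' - 1}. card (load n lam' c) = m" "card (load n lam' v') = n - m * (v' - 1)"
    by blast
  have mv: "m * v' = m * (v' - 1) + m" using vv by (cases v') simp_all
  have "card (load n lam' c) = m" if "c \<in> {1..f}" for c
  proof (cases "c = v'")
    case True
    then have "n = m * v'" using that f False vv by (auto split: if_splits)
    then show ?thesis using E(4) mv True by simp
  next
    case False
    then show ?thesis using E(3) that f by (auto split: if_splits)
  qed
  moreover have "card (load n lam' v') + (m * v' - n - 1) = m - 1" if "f < v'"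
  proof -
    have "n \<noteq> m * v'" using that f by (auto split: if_splits)
    then show ?thesis using E(4) mv low high by linarith
  qed
  ultimately show ?thesis using E(1,2) by (intro exI[of _ lam']) auto
qed

lemma plannable_step:
  assumes P: "plannable n (m - 1) v'" and m: "3 \<le> m" and v': "v' = cut_width n m" "2 * v' \<le> n"
    and v: "v \<le> v'" and cap: "(m - 1) * v' \<le> n"
    and new: "v' = v \<or> m * (v' - 1) < n \<and> n \<le> m * v'"
    and cov: "row_width n (m - 1) = row_width n m \<or> v' = row_width n m \<and> n \<le> m * v'"
  shows "plannable n m v"
  unfolding plannable_def
proof (intro allI impI)
  fix lam rho assume bal: "balanced n m v lam \<and> balanced n m v rho"
  define f where "f = (if v' = v \<or> n = m * v' then v' else v' - 1)"
  have f: "v \<le> f" "f \<le> v'" "v' \<le> f + 1" using v by (auto simp: f_def)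
  have "m * v' = (m - 1) * v' + v'" using m by (cases m) simp_all
  \<comment> \<open>The capacity bound guarantees that there are enough picks to top up the last
    column.\<close>
  then have d: "m * v' - n - 1 \<le> f" using cap f(3) by linarith
  have m0: "0 < m" "2 \<le> m" using m by simp_all
  from extend_or_keep[OF conjunct1[OF bal] m0(1) v new f_def] obtain lamE where
    L: "\<forall>x\<in>{1..n}. lamE x \<le> v'" "\<forall>c\<in>{1..v}. load n lamE c = load n lam c"
      "\<forall>c\<in>{1..f}. card (load n lamE c) = m"
      "f < v' \<longrightarrow> card (load n lamE v') + (m * v' - n - 1) = m - 1"
      "n \<le> m * v' \<longrightarrow> (\<forall>x\<in>{1..n}. lamE x \<in> {1..v'})"
    by blast
  from extend_or_keep[OF conjunct2[OF bal] m0(1) v new f_def] obtain rhoE where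
    R: "\<forall>x\<in>{1..n}. rhoE x \<le> v'" "\<forall>c\<in>{1..v}. load n rhoE c = load n rho c"
      "\<forall>c\<in>{1..f}. card (load n rhoE c) = m"
      "f < v' \<longrightarrow> card (load n rhoE v') + (m * v' - n - 1) = m - 1"
      "n \<le> m * v' \<longrightarrow> (\<forall>x\<in>{1..n}. rhoE x \<in> {1..v'})"
    by blast
  \<comment> \<open>Symbols start at 1, so \<open>a = 0\<close> excludes nothing.\<close>
  from pick_representatives[where f = f and a = 0, OF m0(2) bspec[OF L(3)] bspec[OF R(3)]] obtain p q where
    p: "\<forall>c\<in>{1..f}. p c \<in> load n lamE c" and q: "\<forall>c\<in>{1..f}. q c \<in> load n rhoE c - {0}"
    and pq: "\<forall>c\<in>{1..f}. \<forall>d\<in>{1..f}. p c \<noteq> q d"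
    by blast
  have q': "\<forall>c\<in>{1..f}. q c \<in> load n rhoE c" using q by blast
  from reassign_picks[OF bspec[OF L(1)] f(2,3) d bspec[OF L(3)] mp[OF L(4)] bspec[OF p]]
  obtain lam' where lam': "balanced n (m - 1) v' lam'"
    "\<forall>c\<in>{1..f}. load n lam' c = load n lamE c - {p c}"
    "f < v' \<longrightarrow> load n lamE v' \<subseteq> load n lam' v'" by blast
  from reassign_picks[OF bspec[OF R(1)] f(2,3) d bspec[OF R(3)] mp[OF R(4)] bspec[OF q']]
  obtain rho' where rho': "balanced n (m - 1) v' rho'"
    "\<forall>c\<in>{1..f}. load n rho' c = load n rhoE c - {q c}"
    "f < v' \<longrightarrow> load n rhoE v' \<subseteq> load n rho' v'" by blast
  obtain P' where P': "corner_plan n (m - 1) v' lam' rho' P'"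
    using P lam'(1) rho'(1) unfolding plannable_def by blast
  have cov': "row_width n (m - 1) = row_width n m \<or>
      v' = row_width n m \<and> (\<forall>x\<in>{1..n}. lamE x \<in> {1..v'} \<and> rhoE x \<in> {1..v'})"
    using cov L(5) R(5) by blast
  show "\<exists>P. corner_plan n m v lam rho P"
    by (rule add_row_to_plan[OF P' m v' f(1,2,3) bspec[OF L(2)] bspec[OF R(2)]
          bspec[OF p] bspec[OF q'] bspec[OF bspec[OF pq]] bspec[OF lam'(2)] mp[OF lam'(3)]
          bspec[OF rho'(2)] mp[OF rho'(3)] cov'])
qed

section \<open>Rows 1 and 2\<close>

definition two_sided :: "nat \<Rightarrow> nat \<Rightarrow> (nat \<Rightarrow> nat) \<Rightarrow> (nat \<Rightarrow> nat) \<Rightarrow> nat \<Rightarrow> nat \<Rightarrow> nat" where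
  "two_sided n q l r e c =
     (if c \<in> {1..q} then l c else if c \<le> n \<and> n + 1 - c \<in> {1..q} then r (n + 1 - c)
      else if c \<in> {1..n} then e else 0)"

lemma two_sided_cases:
  assumes "c \<in> {1..n}" "q = n div 2"
  obtains "c \<in> {1..q}" "two_sided n q l r e c = l c"
  | d where "d \<in> {1..q}" "c = n + 1 - d" "two_sided n q l r e c = r d"
  | "odd n" "c = q + 1" "two_sided n q l r e c = e"
proof -
  consider "c \<le> q" | "n + 1 - c \<le> q" "q < c" | "q < c" "q < n + 1 - c" by linarith
  then show thesis
  proof cases
    case 1
    then show ?thesis using that(1) assms by (simp add: two_sided_def)
  next
    case 2
    then show ?thesis using that(2)[of "n + 1 - c"] assms by (simp add: two_sided_def)
  next
    case 3
    then have c: "c = q + 1" using assms by simp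
    then have "odd n" using 3 assms by presburger
    with c show ?thesis using that(3) 3 assms by (simp add: two_sided_def)
  qed
qed

lemma two_sided_left: "c \<in> {1..q} \<Longrightarrow> two_sided n q l r e c = l c"
  by (simp add: two_sided_def)

lemma two_sided_right:
  "c \<in> {1..q} \<Longrightarrow> q = n div 2 \<Longrightarrow> two_sided n q l r e (n + 1 - c) = r c"
  by (auto simp: two_sided_def)

lemma two_sided_middle: "odd n \<Longrightarrow> q = n div 2 \<Longrightarrow> two_sided n q l r e (q + 1) = e"
  by (auto simp: two_sided_def elim!: oddE)

lemma inj_on_two_sided:
  assumes q: "q = n div 2" and l: "inj_on l {1..q}" and r: "inj_on r {1..q}"
    and lr: "\<And>c d. c \<in> {1..q} \<Longrightarrow> d \<in> {1..q} \<Longrightarrow> l c \<noteq> r d"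
    and e: "\<And>c. odd n \<Longrightarrow> c \<in> {1..q} \<Longrightarrow> l c \<noteq> e \<and> r c \<noteq> e"
  shows "inj_on (two_sided n q l r e) {1..n}"
proof (rule inj_onI)
  fix c d assume c: "c \<in> {1..n}" and d: "d \<in> {1..n}"
    and eq: "two_sided n q l r e c = two_sided n q l r e d"
  show "c = d"
    by (rule two_sided_cases[OF c q, of l r e]; rule two_sided_cases[OF d q, of l r e])
      (use eq lr e inj_onD[OF l] inj_onD[OF r] in \<open>metis+\<close>)
qed


lemma ex_other_member:
  assumes "\<And>c. c \<in> {1..f} \<Longrightarrow> card (load n lam c) = 2" "\<And>c. c \<in> {1..f} \<Longrightarrow> p c \<in> load n lam c"
  shows "\<exists>s. \<forall>c\<in>{1..f}. load n lam c = {p c, s c} \<and> s c \<noteq> p c"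
proof -
  have "\<exists>s. load n lam c = {p c, s} \<and> s \<noteq> p c" if c: "c \<in> {1..f}" for c
  proof -
    obtain x y where xy: "load n lam c = {x, y}" "x \<noteq> y"
      using assms(1)[OF c] by (auto simp: card_2_iff)
    then have "p c = x \<or> p c = y" using assms(2)[OF c] by auto
    then show ?thesis using xy by auto
  qed
  then show ?thesis by (intro bchoice ballI)
qed

text \<open>At height two the first \<open>n div 2\<close> columns take two symbols each, which for
  odd \<open>n\<close> leaves one symbol \<open>a\<close> for the middle column; for even
  \<open>n\<close> the value 0 says that there is none. Since \<open>v < n div 2\<close>, an
  unassigned \<open>z\<close> put into column \<open>v + 1\<close> stays out of the middle.\<close>

lemma two_row_assignment:
  assumes bal: "balanced n 2 v lam" and v: "v < n div 2"
  shows "\<exists>lam' a. (\<forall>c\<in>{1..v}. load n lam' c = load n lam c) \<and>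
    (\<forall>c\<in>{1..n div 2}. card (load n lam' c) = 2) \<and>
    (\<forall>x\<in>{1..n}. x \<noteq> a \<longrightarrow> lam' x \<in> {1..n div 2}) \<and>
    (if odd n then a \<in> {1..n} \<and> lam' a = n div 2 + 1 else a = 0) \<and>
    (z \<in> {1..n} \<longrightarrow> a \<noteq> z)"
proof -
  define q where "q = n div 2"
  define v' where "v' = (n + 1) div 2"
  have vv: "v < v'" "2 * (v' - 1) < n" "n \<le> 2 * v'" using v unfolding v'_def by linarith+
  from extend_assignment[OF bal _ vv, of z] obtain lam' where
    E: "\<forall>x\<in>{1..n}. lam' x \<in> {1..v'}" "\<forall>c\<in>{1..v}. load n lam' c = load n lam c"
    "\<forall>c\<in>{1..v' - 1}. card (load n lam' c) = 2" "card (load n lam' v') = n - 2 * (v' - 1)"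
    "z \<in> load n lam 0 \<longrightarrow> lam' z = v + 1"
    by auto
  show ?thesis
  proof (cases "odd n")
    case True
    then have n: "n = 2 * q + 1" "v' = q + 1" unfolding q_def v'_def by presburger+
    then have "card (load n lam' v') = 1" using E(4) by simp
    then obtain a where a: "load n lam' v' = {a}" by (meson card_1_singletonE)
    have "a \<noteq> z" if "z \<in> {1..n}"
    proof (cases "lam z = 0")
      case True
      then have "lam' z = v + 1" using E(5) that by (simp add: load_def)
      then have "z \<notin> load n lam' v'" using v n by (simp add: load_def)
      then show ?thesis using a by auto
    next
      case False
      then have "lam z \<in> {1..v}" using bal that by (auto simp: balanced_def)
      then have "z \<in> load n lam' (lam z)" using E(2) that by (auto simp: load_def)
      then have "lam' z = lam z" by (simp add: load_def)
      then have "z \<notin> load n lam' v'" using \<open>lam z \<in> {1..v}\<close> vv by (simp add: load_def)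
      then show ?thesis using a by auto
    qed
    moreover have "lam' x \<in> {1..q}" if "x \<in> {1..n}" "x \<noteq> a" for x
    proof -
      have "x \<notin> load n lam' v'" using a that(2) by auto
      then have "lam' x \<noteq> v'" using that(1) by (simp add: load_def)
      then show ?thesis using E(1) that(1) n(2) by fastforce
    qed
    moreover have "a \<in> {1..n} \<and> lam' a = q + 1" using a n by (auto simp: load_def)
    moreover have "\<forall>c\<in>{1..q}. card (load n lam' c) = 2" using E(3) n by simp
    ultimately show ?thesis using True E(2)
      unfolding q_def by (intro exI[of _ lam'] exI[of _ a]) auto
  next
    case False
    then have n: "n = 2 * q" "v' = q" unfolding q_def v'_def by presburger+
    have "card (load n lam' c) = 2" if "c \<in> {1..q}" for c
    proof (cases "c = q")
      case True
      then show ?thesis using E(4) n that by simp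
    next
      case False
      then have "c \<in> {1..v' - 1}" using n that by auto
      then show ?thesis using E(3) by blast
    qed
    then show ?thesis using False E(1,2) n(2)
      unfolding q_def by (intro exI[of _ lam'] exI[of _ 0]) auto
  qed
qed

text \<open>For odd \<open>n\<close> both corners share the middle column in rows 1 and 2. It receives \<open>b\<close> and \<open>a\<close>, each of
  which serves one corner only, and \<open>a\<close> is excluded from the picks of the right corner. The picks then
  exhaust all other symbols, so the symbols left for row 1 are again distinct.\<close>

lemma plannable_two:
  assumes v: "v < n div 2"
  shows "plannable n 2 v"
  unfolding plannable_def
proof (intro allI impI)
  fix lam rho assume bal: "balanced n 2 v lam \<and> balanced n 2 v rho"
  define q where "q = n div 2"
  from two_row_assignment[OF conjunct1[OF bal] v, of 0] obtain lamE a where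
    L: "\<forall>c\<in>{1..v}. load n lamE c = load n lam c" "\<forall>c\<in>{1..q}. card (load n lamE c) = 2"
    "\<forall>x\<in>{1..n}. x \<noteq> a \<longrightarrow> lamE x \<in> {1..q}"
    "if odd n then a \<in> {1..n} \<and> lamE a = q + 1 else a = 0"
    unfolding q_def by blast
  \<comment> \<open>Taking \<open>z = a\<close> here forces the two entries of the middle column to
    differ.\<close>
  from two_row_assignment[OF conjunct2[OF bal] v, of a] obtain rhoE b where
    R: "\<forall>c\<in>{1..v}. load n rhoE c = load n rho c" "\<forall>c\<in>{1..q}. card (load n rhoE c) = 2"
    "\<forall>x\<in>{1..n}. x \<noteq> b \<longrightarrow> rhoE x \<in> {1..q}"
    "if odd n then b \<in> {1..n} \<and> rhoE b = q + 1 else b = 0"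
    "a \<in> {1..n} \<longrightarrow> b \<noteq> a"
    unfolding q_def by blast
  have aodd: "a \<in> {1..n}" "lamE a = q + 1" "b \<in> {1..n}" "rhoE b = q + 1" "b \<noteq> a" if "odd n"
    using L(4) R(4,5) that by auto
  from pick_representatives[where f = q and a = a, OF _ bspec[OF L(2)] bspec[OF R(2)]]
  obtain pL pR where pL: "\<forall>c\<in>{1..q}. pL c \<in> load n lamE c"
    and pR: "\<forall>c\<in>{1..q}. pR c \<in> load n rhoE c - {a}"
    and pp: "\<forall>c\<in>{1..q}. \<forall>d\<in>{1..q}. pL c \<noteq> pR d"
    by blast
  from ex_other_member[OF bspec[OF L(2)] bspec[OF pL]] obtain sL where
    sL: "\<forall>c\<in>{1..q}. load n lamE c = {pL c, sL c} \<and> sL c \<noteq> pL c" by blast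
  have "\<forall>c\<in>{1..q}. pR c \<in> load n rhoE c" using pR by blast
  from ex_other_member[OF bspec[OF R(2)] bspec[OF this]] obtain sR where
    sR: "\<forall>c\<in>{1..q}. load n rhoE c = {pR c, sR c} \<and> sR c \<noteq> pR c" by blast
  have lL: "lamE (pL c) = c" "pL c \<in> {1..n}" "lamE (sL c) = c" "sL c \<in> {1..n}" "sL c \<noteq> pL c"
    if "c \<in> {1..q}" for c
  proof -
    have "pL c \<in> load n lamE c" "sL c \<in> load n lamE c" using sL that by auto
    then show "lamE (pL c) = c" "pL c \<in> {1..n}" "lamE (sL c) = c" "sL c \<in> {1..n}"
      by (simp_all add: load_def)
    show "sL c \<noteq> pL c" using sL that by blast
  qed
  have lR: "rhoE (pR c) = c" "pR c \<in> {1..n}" "rhoE (sR c) = c" "sR c \<in> {1..n}" "sR c \<noteq> pR c"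
    "pR c \<noteq> a"
    if "c \<in> {1..q}" for c
  proof -
    have "pR c \<in> load n rhoE c" "sR c \<in> load n rhoE c" using sR that by auto
    then show "rhoE (pR c) = c" "pR c \<in> {1..n}" "rhoE (sR c) = c" "sR c \<in> {1..n}"
      by (simp_all add: load_def)
    show "sR c \<noteq> pR c" using sR that by blast
    show "pR c \<noteq> a" using pR that by blast
  qed
  have inj: "inj_on pL {1..q}" "inj_on sL {1..q}" "inj_on pR {1..q}" "inj_on sR {1..q}"
    by (rule inj_on_inverseI[of _ lamE] inj_on_inverseI[of _ rhoE], simp add: lL lR)+
  \<comment> \<open>The \<open>2 * q\<close> picks are distinct and avoid \<open>a\<close>, and
    exactly \<open>2 * q\<close> symbols differ from \<open>a\<close>, both for odd \<open>n\<close>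
    and for even \<open>n\<close> with \<open>a = 0\<close>.\<close>
  have pick: "x \<in> pL ` {1..q} \<or> x \<in> pR ` {1..q}" if x: "x \<in> {1..n}" "x \<noteq> a" for x
  proof -
    have "pL c \<noteq> a" if "c \<in> {1..q}" for c
      using lL(1,2)[OF that] L(4) that by (auto split: if_splits)
    then have sub: "pL ` {1..q} \<union> pR ` {1..q} \<subseteq> {1..n} - {a}"
      using lL(2) lR(2,6) by blast
    have "card (pL ` {1..q} \<union> pR ` {1..q}) = card (pL ` {1..q}) + card (pR ` {1..q})"
      by (rule card_Un_disjoint) (use pp in auto)
    also have "\<dots> = 2 * q" using inj by (simp add: card_image)
    also have "\<dots> = card ({1..n} - {a})" using L(4) by (auto simp: q_def elim: oddE split: if_splits)
    finally have "pL ` {1..q} \<union> pR ` {1..q} = {1..n} - {a}"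
      using sub by (intro card_subset_eq) simp_all
    then show ?thesis using x by blast
  qed
  have rest: "x \<notin> pL ` {1..q}" if "x = sL c" "c \<in> {1..q}" for x c
  proof
    assume "x \<in> pL ` {1..q}"
    then obtain d where "d \<in> {1..q}" "x = pL d" by blast
    then show False using lL that by metis
  qed
  have restR: "x \<notin> pR ` {1..q}" if "x = sR c" "c \<in> {1..q}" for x c
  proof
    assume "x \<in> pR ` {1..q}"
    then obtain d where "d \<in> {1..q}" "x = pR d" by blast
    then show False using lR that by metis
  qed
  have sLa: "sL c \<noteq> a" if "c \<in> {1..q}" for c
    using lL(3,4)[OF that] L(4) that by (auto split: if_splits)
  \<comment> \<open>A left remainder is not a left pick, so by the count it is a right pick, which
    no right remainder is.\<close>
  have ss: "sL c \<noteq> sR d" if c: "c \<in> {1..q}" and d: "d \<in> {1..q}" for c d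
    using pick[OF lL(4)[OF c] sLa[OF c]] rest[OF refl c] restR[of "sL c", OF _ d] by blast
  \<comment> \<open>Likewise a left remainder equal to \<open>b\<close> would be a right pick, but
    \<open>rhoE\<close> puts \<open>b\<close> into the middle column, from which nothing is
    picked.\<close>
  have sLb: "sL c \<noteq> b" if "odd n" and c: "c \<in> {1..q}" for c
  proof
    assume b: "sL c = b"
    then have "b \<in> pR ` {1..q}"
      using pick[OF lL(4)[OF c] sLa[OF c]] rest[OF refl c] by simp
    then obtain d where "d \<in> {1..q}" "b = pR d" by blast
    then show False using lR(1)[of d] aodd(4)[OF that(1)] by simp
  qed
  \<comment> \<open>Row 2 takes the picks and \<open>a\<close>, row 1 the remainders and
    \<open>b\<close>.\<close>
  define g1 where "g1 = two_sided n q sL sR b"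
  define g2 where "g2 = two_sided n q pL pR a"
  define P :: array where "P r c = (if r = 1 then g1 c else if r = 2 then g2 c else 0)" for r c
  have P1: "P 1 = g1" and P2: "P 2 = g2" by (simp_all add: P_def fun_eq_iff)
  have inj1: "inj_on g1 {1..n}"
    unfolding g1_def
  proof (rule inj_on_two_sided[OF q_def inj(2,4) ss])
    fix c assume "odd n" "c \<in> {1..q}"
    then show "sL c \<noteq> b \<and> sR c \<noteq> b" using sLb aodd(4) lR(3)[of c] by auto
  qed
  have inj2: "inj_on g2 {1..n}"
    unfolding g2_def
  proof (rule inj_on_two_sided[OF q_def inj(1,3)])
    fix c assume "odd n" "c \<in> {1..q}"
    then show "pL c \<noteq> a \<and> pR c \<noteq> a" using lR(6) aodd(2) lL(1)[of c] by auto
  qed (use pp in blast)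
  have g: "g1 c \<in> {1..n} \<and> g2 c \<in> {1..n} \<and> g1 c \<noteq> g2 c" if c: "c \<in> {1..n}" for c
  proof -
    consider "c \<in> {1..q}" | d where "d \<in> {1..q}" "c = n + 1 - d" | "odd n" "c = q + 1"
      using two_sided_cases[OF c q_def] by metis
    then show ?thesis
    proof cases
      case 1
      then show ?thesis using lL by (simp add: g1_def g2_def two_sided_left)
    next
      case 2
      have "g1 c = sR d" "g2 c = pR d"
        unfolding 2(2) g1_def g2_def by (rule two_sided_right[OF 2(1) q_def])+
      then show ?thesis using lR[OF 2(1)] by simp
    next
      case 3
      have "g1 c = b" "g2 c = a"
        unfolding 3(2) g1_def g2_def by (rule two_sided_middle[OF 3(1) q_def])+
      then show ?thesis using aodd[OF 3(1)] by simp
    qed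
  qed
  have r2: "{1..2} = {1, 2::nat}" by auto
  have setL: "(\<lambda>r. P r c) ` {1..2} = load n lamE c" if "c \<in> {1..q}" for c
  proof -
    have "P 1 c = sL c" "P 2 c = pL c"
      unfolding P1 P2 g1_def g2_def by (rule two_sided_left[OF that])+
    then have "(\<lambda>r. P r c) ` {1..2} = {sL c, pL c}" unfolding r2 by simp
    then show ?thesis using sL that by auto
  qed
  have setR: "(\<lambda>r. P r (n + 1 - c)) ` {1..2} = load n rhoE c" if "c \<in> {1..q}" for c
  proof -
    have "P 1 (n + 1 - c) = sR c" "P 2 (n + 1 - c) = pR c"
      unfolding P1 P2 g1_def g2_def by (rule two_sided_right[OF that q_def])+
    then have "(\<lambda>r. P r (n + 1 - c)) ` {1..2} = {sR c, pR c}" unfolding r2 by simp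
    then show ?thesis using sR that by auto
  qed
  have w: "q \<le> row_width n 2" "odd n \<Longrightarrow> q + 1 \<le> row_width n 2"
    unfolding row_width_def q_def by presburger+
  have "corner_plan n 2 v lam rho P"
    unfolding corner_plan_def
  proof (intro conjI allI ballI impI)
    fix r c
    show "P r c \<le> n"
    proof (cases "c \<in> {1..n}")
      case True
      then show ?thesis using g[OF True] by (simp add: P_def)
    next
      case False
      then have "g1 c = 0" "g2 c = 0"
        by (auto simp: g1_def g2_def two_sided_def q_def)
      then show ?thesis by (simp add: P_def)
    qed
  next
    fix r assume "r \<in> {1..2::nat}"
    then have "P r = g1 \<or> P r = g2" using P1 P2 unfolding r2 by auto
    moreover have "inj_on g1 {c \<in> {1..n}. P r c \<noteq> 0}" "inj_on g2 {c \<in> {1..n}. P r c \<noteq> 0}"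
      by (rule inj_on_subset[OF inj1] inj_on_subset[OF inj2], blast)+
    ultimately show "inj_on (P r) {c \<in> {1..n}. P r c \<noteq> 0}" by auto
  next
    fix r r' c assume "r \<in> {1..2::nat}" "r' \<in> {1..<r}" and c: "c \<in> {1..n}"
    then have "r = 2" "r' = 1" by auto
    then show "P r' c \<noteq> 0" "P r' c \<noteq> P r c" using g[OF c] P1 P2 by auto
  next
    fix c assume c: "c \<in> {1..v}"
    then have "c \<in> {1..q}" using v by (simp add: q_def)
    then show "(\<lambda>r. P r c) ` {1..2} = load n lam c" "(\<lambda>r. P r (n + 1 - c)) ` {1..2} = load n rho c"
      using setL setR L(1) R(1) c by simp_all
  next
    fix i x assume "i \<in> {2..2::nat}" and x: "x \<in> {1..n}"
    then have i: "i = 2" by simp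
    have "\<exists>c\<in>{1..row_width n 2}. x \<in> (\<lambda>r. P r c) ` {1..2}"
    proof (cases "x = a")
      case True
      then have "odd n" using L(4) x by (auto split: if_splits)
      then have "P 2 (q + 1) = x" unfolding P2 g2_def True by (rule two_sided_middle[OF _ q_def])
      then show ?thesis using w(2)[OF \<open>odd n\<close>] by (intro bexI[of _ "q + 1"]) (auto simp: r2)
    next
      case False
      then have "lamE x \<in> {1..q}" using L(3) x by blast
      then show ?thesis using setL[of "lamE x"] w(1) x
        by (intro bexI[of _ "lamE x"]) (auto simp: load_def)
    qed
    then show "\<exists>r\<in>{1..i}. \<exists>c\<in>{1..row_width n i}. P r c = x" unfolding i by blast
    have "\<exists>c\<in>{1..row_width n 2}. x \<in> (\<lambda>r. P r (n + 1 - c)) ` {1..2}"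
    proof (cases "x = b")
      case True
      then have o: "odd n" using R(4) x by (auto split: if_splits)
      then have "P 1 (q + 1) = x" unfolding P1 g1_def True by (rule two_sided_middle[OF _ q_def])
      moreover have "n + 1 - (q + 1) = q + 1" using o unfolding q_def by presburger
      ultimately show ?thesis using w(2)[OF o] by (intro bexI[of _ "q + 1"]) (auto simp: r2)
    next
      case False
      then have "rhoE x \<in> {1..q}" using R(3) x by blast
      then show ?thesis using setR[of "rhoE x"] w(1) x
        by (intro bexI[of _ "rhoE x"]) (auto simp: load_def)
    qed
    then show "\<exists>r\<in>{1..i}. \<exists>c\<in>{1..row_width n i}. P r (n + 1 - c) = x" unfolding i by blast
  next
    fix r c assume "r \<in> {3..2::nat}"
    then show "c \<le> cut_width n r \<or> n + 1 - c \<le> cut_width n r" by simp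
  next
    fix r :: nat and c assume "r \<in> {1, 2}" and c: "c \<in> {1..n}"
    then have "r = 1 \<or> r = 2" by simp
    then show "P r c \<noteq> 0" using g[OF c] P1 P2 by auto
  qed
  then show "\<exists>P. corner_plan n 2 v lam rho P" by blast
qed


section \<open>Arithmetic of the widths and induction on the height\<close>

lemma mult_row_width:
  assumes "0 < m" "0 < n"
  shows "n \<le> m * row_width n m" "m * (row_width n m - 1) < n"
proof -
  have "n - 1 < m * ((n - 1) div m + 1)"
    using dividend_less_div_times[OF assms(1), of "n - 1"] by (simp add: mult.commute)
  then show "n \<le> m * row_width n m" by (simp add: row_width_def)
  have "m * ((n - 1) div m) \<le> n - 1" by simp
  then have "m * ((n - 1) div m) < n" using assms(2) by linarith
  then show "m * (row_width n m - 1) < n" by (simp add: row_width_def)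
qed

lemma cut_width_Suc_le: "2 \<le> m \<Longrightarrow> cut_width n (m + 1) \<le> cut_width n m"
  unfolding cut_width_def row_width_def by (auto simp: min_le_iff_disj intro!: div_le_mono2)

text \<open>Either row \<open>m\<close> works in the full width of its rectangle, or it opens no
  column and the rectangle one row higher has the same width. In the latter case the quotients by
  \<open>m - 1\<close> and \<open>m\<close> have a common value \<open>k\<close>, which forces
  \<open>k + 1 < m\<close>.\<close>

lemma cut_width_step:
  assumes m: "3 \<le> m" and n: "0 < n"
  shows "(cut_width n m = row_width n m \<and> m * (cut_width n m - 1) < n \<and> n \<le> m * cut_width n m) \<or>
    (cut_width n m = cut_width n (m + 1) \<and> row_width n (m - 1) = row_width n m)"
proof (cases "row_width n m \<le> (n - 1) div (m - 1)")
  case True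
  then have "cut_width n m = row_width n m" by (simp add: cut_width_def)
  then show ?thesis using mult_row_width[of m n] m n by simp
next
  case False
  define k where "k = (n - 1) div m"
  have "k \<le> (n - 1) div (m - 1)" unfolding k_def by (rule div_le_mono2) (use m in auto)
  then have k: "(n - 1) div (m - 1) = k" using False by (simp add: row_width_def k_def)
  have "n - 1 < (m - 1) * (k + 1)"
    using dividend_less_div_times[of "m - 1" "n - 1"] m k by (simp add: mult.commute)
  moreover have "m * k \<le> n - 1" by (simp add: k_def)
  moreover have "(m - 1) * (k + 1) + k + 1 = m * k + m" using m by (cases m) simp_all
  ultimately have "k + 1 < m" by linarith
  \<comment> \<open>For such small quotients, passing from \<open>m\<close> to \<open>m + 1\<close>
    lowers the quotient by at most one, so row \<open>m + 1\<close> has the same cut width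
    \<open>k\<close>.\<close>
  have "k \<le> (n - 1) div (m + 1) + 1"
  proof (cases k)
    case (Suc j)
    have "j * (m + 1) \<le> m * k" using Suc \<open>k + 1 < m\<close> by (simp add: algebra_simps)
    then have "j * (m + 1) \<le> n - 1" using \<open>m * k \<le> n - 1\<close> by linarith
    then have "j \<le> (n - 1) div (m + 1)" by (simp add: less_eq_div_iff_mult_less_eq)
    then show ?thesis using Suc by simp
  qed simp
  then have "cut_width n (m + 1) = k" "cut_width n m = k"
    using k k_def by (simp_all add: cut_width_def row_width_def)
  then show ?thesis using k by (simp add: row_width_def k_def)
qed

lemma cut_width_mult_le: "(m - 1) * cut_width n m \<le> n"
proof -
  have "(m - 1) * cut_width n m \<le> (m - 1) * ((n - 1) div (m - 1))"
    by (rule mult_le_mono2) (simp add: cut_width_def)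
  also have "\<dots> \<le> n - 1" by simp
  finally show ?thesis by simp
qed

lemma cut_width_le_half:
  assumes "3 \<le> m" "8 \<le> n"
  shows "cut_width n m < n div 2"
proof -
  have "cut_width n m \<le> (n - 1) div m + 1" by (simp add: cut_width_def row_width_def)
  also have "(n - 1) div m \<le> (n - 1) div 3" by (rule div_le_mono2) (use assms in auto)
  finally show ?thesis using assms(2) by presburger
qed

text \<open>The width is that of row \<open>m + 1\<close>, because those are the columns already
  opened when the filling has reached row \<open>m\<close> from below.\<close>

lemma plannable_cut_width:
  assumes n: "8 \<le> n" and m: "2 \<le> m"
  shows "plannable n m (cut_width n (m + 1))"
  using m
proof (induction m rule: dec_induct)
  case base
  show ?case by (rule plannable_two) (use cut_width_le_half[of 3 n] n in simp)
next
  case (step m)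
  define M where "M = m + 1"
  have M: "3 \<le> M" using step by (simp add: M_def)
  have "plannable n M (cut_width n (M + 1))"
  proof (rule plannable_step[OF _ M refl])
    show "plannable n (M - 1) (cut_width n M)" using step by (simp add: M_def)
    show "2 * cut_width n M \<le> n" using cut_width_le_half[OF M n] by linarith
    show "cut_width n (M + 1) \<le> cut_width n M" by (rule cut_width_Suc_le) (use M in simp)
    show "(M - 1) * cut_width n M \<le> n" by (rule cut_width_mult_le)
    show "cut_width n M = cut_width n (M + 1) \<or>
      M * (cut_width n M - 1) < n \<and> n \<le> M * cut_width n M"
      "row_width n (M - 1) = row_width n M \<or>
      cut_width n M = row_width n M \<and> n \<le> M * cut_width n M"
      using cut_width_step[OF M, of n] n by auto
  qed
  then show ?case by (simp add: M_def)
qed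

text \<open>The filling starts here, with two columns per corner. For even \<open>n\<close> the cut
  width of row \<open>K + 1\<close> is only 1, so \<open>plannable_cut_width\<close> is applied at
  height \<open>K - 1\<close> and followed by a step that keeps both columns.\<close>

lemma plannable_half:
  assumes n: "8 \<le> n" and K: "K = n div 2"
  shows "plannable n K 2" "cut_width n K = 2"
proof -
  have K4: "4 \<le> K" using n K by simp
  consider "n = 2 * K" | "n = 2 * K + 1" using K by linarith
  then have "cut_width n K = 2 \<and> (row_width n (K - 1) = row_width n K \<or>
    2 = row_width n K \<and> n \<le> K * 2)"
  proof cases
    case 1
    have "(n - 1) div (K - 1) = 2" by (rule div_nat_eqI) (use 1 K4 in simp_all)
    moreover have "(n - 1) div K = 1" by (rule div_nat_eqI) (use 1 K4 in simp_all)
    ultimately show ?thesis using 1 by (simp add: cut_width_def row_width_def)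
  next
    case 2
    have "(n - 1) div (K - 1) = 2" by (rule div_nat_eqI) (use 2 K4 in simp_all)
    moreover have "(n - 1) div K = 2" by (rule div_nat_eqI) (use 2 K4 in simp_all)
    ultimately show ?thesis by (simp add: cut_width_def row_width_def)
  qed
  then have c: "cut_width n K = 2" and
    w: "row_width n (K - 1) = row_width n K \<or> 2 = row_width n K \<and> n \<le> K * 2"
    by blast+
  show "cut_width n K = 2" by (rule c)
  show "plannable n K 2"
  proof (rule plannable_step[where v' = 2])
    show "plannable n (K - 1) 2" using plannable_cut_width[OF n, of "K - 1"] K4 c by simp
  qed (use c w K4 n K in auto)
qed

section \<open>Completion to a latin square\<close>

lemma rect_width_eq_row_width:
  assumes "1 \<le> n" "1 \<le> i"
  shows "rect_width n i = row_width n i"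
proof -
  define k where "k = (n - 1) div i"
  have i: "0 < i" "0 < n" using assms by simp_all
  have "n \<le> i * (k + 1)" "i * k < n"
    using mult_row_width[OF i] by (simp_all add: row_width_def k_def)
  then have "real n \<le> real i * (real k + 1)" "real i * real k < real n"
    using of_nat_le_iff[of n "i * (k + 1)", where ?'a = real]
      of_nat_less_iff[of "i * k" n, where ?'a = real] by (simp_all only: of_nat_mult of_nat_add of_nat_1)
  then have "real n / real i \<le> real k + 1" "real k < real n / real i"
    using i by (simp_all add: field_simps)
  then have "\<lceil>real n / real i\<rceil> = int k + 1" by (intro ceiling_unique) simp_all
  then show ?thesis by (simp add: rect_width_def row_width_def k_def)
qed

definition covers_corners :: "nat \<Rightarrow> nat \<Rightarrow> array \<Rightarrow> bool" where
  "covers_corners n i A \<longleftrightarrow> (\<forall>x\<in>{1..n}.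
     (\<exists>r\<in>{1..i}. \<exists>c\<in>{1..row_width n i}. A r c = x) \<and>
     (\<exists>r\<in>{1..i}. \<exists>c\<in>{1..row_width n i}. A r (n + 1 - c) = x))"

lemma covers_corners_mono:
  assumes "covers_corners n i A" "i \<le> j" "row_width n i \<le> row_width n j"
  shows "covers_corners n j A"
  unfolding covers_corners_def
proof (intro ballI conjI)
  have sub: "{1..i} \<subseteq> {1..j}" "{1..row_width n i} \<subseteq> {1..row_width n j}" using assms(2,3) by auto
  fix x assume x: "x \<in> {1..n}"
  show "\<exists>r\<in>{1..j}. \<exists>c\<in>{1..row_width n j}. A r c = x"
    using assms(1) x sub unfolding covers_corners_def by blast
  show "\<exists>r\<in>{1..j}. \<exists>c\<in>{1..row_width n j}. A r (n + 1 - c) = x"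
    using assms(1) x sub unfolding covers_corners_def by blast
qed

lemma lrpa_type12_if_covers:
  assumes n: "1 \<le> n" and A: "latin_rect n n A" and cov: "\<And>i. i \<in> {1..n} \<Longrightarrow> covers_corners n i A"
  shows "lrpa_type12 n A"
proof -
  have rows: "rows_perm n A" using A by (simp add: rows_perm_def latin_rect_def)
  have cols: "cols_perm n A"
    unfolding cols_perm_def
  proof
    fix c assume c: "c \<in> {1..n}"
    have "(\<lambda>r. A r c) ` {1..n} = {1..n}"
      using latin_rect_column_card[OF A c] by (intro card_subset_eq) simp_all
    then show "bij_betw (\<lambda>r. A r c) {1..n} {1..n}"
      using A c by (simp add: latin_rect_def bij_betw_def)
  qed
  have "{1..n} \<subseteq> symbols_in A {1..i} {1..rect_width n i}"
    "{1..n} \<subseteq> symbols_in A {1..i} {n - rect_width n i + 1..n}" if i: "i \<in> {1..n}" for i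
  proof -
    have w: "rect_width n i = row_width n i"
      by (rule rect_width_eq_row_width) (use n i in auto)
    show "{1..n} \<subseteq> symbols_in A {1..i} {1..rect_width n i}"
    proof
      fix x assume "x \<in> {1..n}"
      then obtain r c where "r \<in> {1..i}" "c \<in> {1..row_width n i}" "A r c = x"
        using cov[OF i] unfolding covers_corners_def by blast
      then show "x \<in> symbols_in A {1..i} {1..rect_width n i}"
        unfolding symbols_in_def w by blast
    qed
    show "{1..n} \<subseteq> symbols_in A {1..i} {n - rect_width n i + 1..n}"
    proof
      fix x assume "x \<in> {1..n}"
      then obtain r c where rc: "r \<in> {1..i}" "c \<in> {1..row_width n i}" "A r (n + 1 - c) = x"
        using cov[OF i] unfolding covers_corners_def by blast
      moreover have "row_width n i \<le> n"
        using n div_le_dividend[of "n - 1" i] unfolding row_width_def by linarith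
      ultimately have "n + 1 - c \<in> {n - row_width n i + 1..n}" by auto
      then show "x \<in> symbols_in A {1..i} {n - rect_width n i + 1..n}"
        using rc unfolding symbols_in_def w by blast
    qed
  qed
  then show ?thesis
    using rows cols by (simp add: lrpa_type12_def latin_square_def rpa_type1_def rpa_type2_def)
qed

text \<open>Below the middle any latin completion will do: for \<open>m < i < n\<close> the
  rectangle contains the \<open>m\<close>-th one, whose width is at most 2, and for
  \<open>i = n\<close> it is a full column of a latin square.\<close>

lemma lrpa_of_top_half:
  assumes n: "1 \<le> n" and m: "m = (n + 1) div 2" and A: "latin_rect n m A"
    and cov: "\<And>i. i \<in> {1..m} \<Longrightarrow> covers_corners n i A"
  shows "\<exists>B. lrpa_type12 n B"
proof -
  have mn: "m \<le> n" "1 \<le> m" using m n by linarith+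
  obtain B where B: "latin_rect n n B" and BA: "\<forall>r\<in>{1..m}. B r = A r"
    using latin_rect_completes[OF A mn(1)] by blast
  have covB: "covers_corners n i B" if i: "i \<in> {1..m}" for i
  proof -
    have "B r = A r" if "r \<in> {1..i}" for r using BA i that by auto
    then show ?thesis using cov[OF i] unfolding covers_corners_def by simp
  qed
  have "covers_corners n i B" if i: "i \<in> {1..n}" for i
  proof -
    consider "i \<le> m" | "m < i" "i < n" | "i = n" using i by fastforce
    then show ?thesis
    proof cases
      case 1
      then show ?thesis using covB[of i] i by simp
    next
      case 2
      have "(n - 1) div m < 2" by (rule div_less_iff_less_mult[THEN iffD2]) (use m n in auto)
      moreover have "0 < (n - 1) div i" using 2 by (simp add: div_greater_zero_iff)
      ultimately have "row_width n m \<le> row_width n i" by (simp add: row_width_def)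
      then show ?thesis using covers_corners_mono[OF covB[of m]] mn 2 by simp
    next
      case 3
      have "\<exists>r\<in>{1..n}. B r c = x" if "x \<in> {1..n}" "c \<in> {1..n}" for x c
      proof -
        have "(\<lambda>r. B r c) ` {1..n} = {1..n}"
          using latin_rect_column_card[OF B that(2)] by (intro card_subset_eq) simp_all
        then show ?thesis using that(1) by (metis (no_types, lifting) imageE)
      qed
      moreover have "1 \<in> {1..row_width n n}" by (simp add: row_width_def)
      moreover have "1 \<in> {1..n}" "n + 1 - 1 \<in> {1..n}" using n by simp_all
      ultimately show ?thesis unfolding covers_corners_def 3 by meson
    qed
  qed
  then show ?thesis using lrpa_type12_if_covers[OF n B] by blast
qed

text \<open>This is the room inequality. With \<open>k\<close> the quotient
  \<open>(n - 1) div r\<close>, the main case uses \<open>(r - 3) * (k - 3) \<ge> 0\<close> and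
  \<open>r * k \<le> n - 1\<close>. For odd \<open>n\<close> and \<open>r = n div 2\<close> the
  width is 3 and the bound would fail by one.\<close>

lemma width_plus_height_le:
  assumes r: "3 \<le> r" "r \<le> n div 2" and ne: "even n \<or> r \<noteq> n div 2"
  shows "2 * r + 2 * row_width n r \<le> n + 4"
proof -
  define k where "k = (n - 1) div r"
  have rk: "r * k \<le> n - 1" by (simp add: k_def)
  have r2: "2 * r \<le> n" using r(2) by presburger
  consider "k \<le> 1" | "k = 2" | "3 \<le> k" by linarith
  then have "2 * r + 2 * k + 2 \<le> n + 4"
  proof cases
    case 1
    then show ?thesis using r2 by linarith
  next
    case 2
    then have "r * 2 \<le> n - 1" using rk by simp
    moreover have "r \<noteq> n div 2 \<or> 2 * r = n" using ne by auto
    ultimately have "2 * r + 2 \<le> n" using r by presburger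
    then show ?thesis using 2 by simp
  next
    case 3
    then obtain i j where "r = i + 3" "k = j + 3" using r(1) by (metis add.commute le_Suc_ex)
    then have "3 * r + 3 * k \<le> r * k + 9" "9 \<le> r * k" by (simp_all add: algebra_simps)
    then show ?thesis using rk by linarith
  qed
  then show ?thesis by (simp add: row_width_def k_def)
qed


lemma covers_corners_if_prescribed:
  assumes n: "2 \<le> n" and i: "2 \<le> i"
    and L: "\<And>x. x \<in> {1..n} \<Longrightarrow> \<exists>r\<in>{1..i}. \<exists>c\<in>{1..row_width n i}. P r c = x"
    and R: "\<And>x. x \<in> {1..n} \<Longrightarrow> \<exists>r\<in>{1..i}. \<exists>c\<in>{1..row_width n i}. P r (n + 1 - c) = x"
    and A: "\<And>r c. r \<in> {1..i} \<Longrightarrow> c \<in> {1..n} \<Longrightarrow> P r c \<noteq> 0 \<Longrightarrow> A r c = P r c"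
  shows "covers_corners n i A"
  unfolding covers_corners_def
proof (intro ballI conjI)
  fix x assume x: "x \<in> {1..n}"
  have "(n - 1) div i \<le> (n - 1) div 2" by (rule div_le_mono2) (use i in auto)
  then have w: "row_width n i \<le> n" using n unfolding row_width_def by linarith
  obtain r c where rc: "r \<in> {1..i}" "c \<in> {1..row_width n i}" "P r c = x" using L[OF x] by blast
  then have "A r c = x" using A[of r c] x w by auto
  then show "\<exists>r\<in>{1..i}. \<exists>c\<in>{1..row_width n i}. A r c = x" using rc by blast
  obtain r c where rc: "r \<in> {1..i}" "c \<in> {1..row_width n i}" "P r (n + 1 - c) = x"
    using R[OF x] by blast
  have "n + 1 - c \<in> {1..n}" using rc(2) w by auto
  then have "A r (n + 1 - c) = x" using A[OF rc(1), of "n + 1 - c"] rc(3) x by simp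
  then show "\<exists>r\<in>{1..i}. \<exists>c\<in>{1..row_width n i}. A r (n + 1 - c) = x" using rc by blast
qed

lemma covers_corners_one:
  assumes n: "1 \<le> n" and A: "latin_rect n m A" "1 \<le> m"
  shows "covers_corners n 1 A"
  unfolding covers_corners_def
proof
  fix x assume x: "x \<in> {1..n}"
  have w: "row_width n 1 = n" using n by (simp add: row_width_def)
  have "A 1 ` {1..n} = {1..n}" using A by (auto simp: latin_rect_def bij_betw_def)
  then obtain c where c: "c \<in> {1..n}" "A 1 c = x" using x by (metis imageE)
  then have "n + 1 - c \<in> {1..n}" "A 1 (n + 1 - (n + 1 - c)) = x" by auto
  then have "\<exists>d\<in>{1..n}. A 1 (n + 1 - d) = x" by blast
  then show "(\<exists>r\<in>{1..1}. \<exists>c\<in>{1..row_width n 1}. A r c = x) \<and>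
      (\<exists>r\<in>{1..1}. \<exists>c\<in>{1..row_width n 1}. A r (n + 1 - c) = x)"
    using c unfolding w by auto
qed

text \<open>For odd \<open>n\<close> the left and right assignments are chosen almost complementary, so that a symbol that
  is not prescribed in row \<open>n div 2 + 1\<close> lies above in the first or in the last column. This is the
  room condition of \<open>partial_rows_complete\<close> for that row.\<close>

definition left_start :: "nat \<Rightarrow> nat \<Rightarrow> nat" where
  "left_start K x = (if x \<le> K then 1 else if x \<le> 2 * K then 2 else 0)"

definition right_start :: "nat \<Rightarrow> nat \<Rightarrow> nat" where
  "right_start n x =
     (let K = n div 2 in if K < x \<and> x \<le> 2 * K then 1 else if odd n \<and> x = 1 then 0 else 2)"

lemma balanced_left_start: "balanced n (n div 2) 2 (left_start (n div 2))"
proof -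
  define K where "K = n div 2"
  have n: "2 * K \<le> n" by (simp add: K_def)
  have "load n (left_start K) 1 = {1..K}" "load n (left_start K) 2 = {K + 1..2 * K}"
    using n by (auto simp: load_def left_start_def split: if_splits)
  moreover have "{1..2} = {1, 2::nat}" by auto
  ultimately show ?thesis
    unfolding balanced_def K_def[symmetric] by (auto simp: left_start_def)
qed

lemma balanced_right_start:
  assumes "2 \<le> n"
  shows "balanced n (n div 2) 2 (right_start n)"
proof -
  define K where "K = n div 2"
  have n: "2 * K \<le> n" "1 \<le> K" "n \<le> 2 * K + 1" "odd n \<Longrightarrow> n = 2 * K + 1" "even n \<Longrightarrow> n = 2 * K"
    using assms unfolding K_def by presburger+
  have "load n (right_start n) 1 = {K + 1..2 * K}"
    using n by (auto simp: load_def right_start_def Let_def K_def[symmetric] split: if_splits)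
  moreover have "card (load n (right_start n) 2) = K"
  proof (cases "odd n")
    case True
    then have "load n (right_start n) 2 = {2..K} \<union> {n}"
      using n by (auto simp: load_def right_start_def Let_def K_def[symmetric] split: if_splits)
    then show ?thesis using n True by simp
  next
    case False
    then have "load n (right_start n) 2 = {1..K}"
      using n by (auto simp: load_def right_start_def Let_def K_def[symmetric] split: if_splits)
    then show ?thesis by simp
  qed
  moreover have "{1..2} = {1, 2::nat}" by auto
  ultimately show ?thesis
    unfolding balanced_def K_def[symmetric] by (auto simp: right_start_def Let_def)
qed

section \<open>Orders from 8 on\<close>

lemma ex_lrpa_ge_8:
  assumes n: "8 \<le> n"
  shows "\<exists>A. lrpa_type12 n A"
proof -
  define K where "K = n div 2"
  define M where "M = (n + 1) div 2"
  have K4: "4 \<le> K" using n by (simp add: K_def)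
  have ev: "n = 2 * K" "M = K" if "even n" using that by (auto simp: K_def M_def)
  have od: "n = 2 * K + 1" "M = K + 1" if "odd n" using that by (auto simp: K_def M_def elim: oddE)
  have nK: "2 * K \<le> n" by (simp add: K_def)
  have n12: "1 \<le> n" "2 \<le> n" using n by simp_all
  obtain P where P: "corner_plan n K 2 (left_start K) (right_start n) P"
    using plannable_half(1)[OF n K_def] balanced_left_start[of n] balanced_right_start[OF n12(2)]
    unfolding plannable_def K_def by blast
  note Ple = corner_planD(1)[OF P] and Prow = corner_planD(2)[OF P] and Pcol = corner_planD(3)[OF P]
    and PL = corner_planD(4)[OF P] and PR = corner_planD(5)[OF P] and covL = corner_planD(6)[OF P]
    and covR = corner_planD(7)[OF P] and Pdom = corner_planD(8)[OF P] and Pfull = corner_planD(9)[OF P]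
  \<comment> \<open>For odd \<open>n\<close> row \<open>K + 1\<close> also gets two entries: the
    symbols left unassigned by the starts, \<open>n\<close> on the left and 1 on the right. Above
    them, column 1 holds the symbols up to \<open>K\<close> and column \<open>n\<close> those from
    \<open>K + 1\<close> to \<open>2 * K\<close>, so nothing repeats.\<close>
  define e where "e c = (if c = 1 then n else if c = n then 1 else 0)" for c
  define Q where "Q = (if odd n then P(K + 1 := e) else P)"
  have QP: "Q r = P r" if "r \<le> K" for r using that by (simp add: Q_def)
  have Qe: "Q (K + 1) = e" if "odd n" using that by (simp add: Q_def)
  have rM: "r \<le> K \<or> odd n \<and> r = K + 1" if "r \<in> {1..M}" for r
    using that ev od by (cases "odd n") auto
  have PL1: "(\<lambda>r. P r 1) ` {1..K} = load n (left_start K) 1" by (rule PL) simp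
  have PR1: "(\<lambda>r. P r (n + 1 - 1)) ` {1..K} = load n (right_start n) 1" by (rule PR) simp
  have load_left: "load n (left_start K) 1 = {1..K}"
    using nK by (auto simp: load_def left_start_def split: if_splits)
  have load_right: "load n (right_start n) 1 = {K + 1..2 * K}"
    using nK by (auto simp: load_def right_start_def Let_def K_def[symmetric] split: if_splits)
  have inL: "\<exists>r\<in>{1..K}. P r (left_start K x) = x" if "x \<in> {1..n}" "x \<le> 2 * K" for x
  proof -
    have "left_start K x \<in> {1..2}" "x \<in> load n (left_start K) (left_start K x)"
      using that by (auto simp: left_start_def load_def)
    then have "x \<in> (\<lambda>r. P r (left_start K x)) ` {1..K}" using PL[of "left_start K x"] by simp
    then show ?thesis by (metis (no_types, lifting) imageE)
  qed
  have inR: "\<exists>r\<in>{1..K}. P r (n + 1 - right_start n x) = x"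
    if "x \<in> {1..n}" "even n \<or> x \<noteq> 1" for x
  proof -
    have "right_start n x \<in> {1..2}" "x \<in> load n (right_start n) (right_start n x)"
      using that by (auto simp: right_start_def Let_def load_def)
    then have "x \<in> (\<lambda>r. P r (n + 1 - right_start n x)) ` {1..K}"
      using PR[of "right_start n x"] by simp
    then show ?thesis by (metis (no_types, lifting) imageE)
  qed
  have "\<exists>A. latin_rect n M A \<and> (\<forall>r\<in>{1..M}. \<forall>c\<in>{1..n}. Q r c \<noteq> 0 \<longrightarrow> A r c = Q r c)"
  proof (rule partial_rows_complete)
    fix r c
    show "Q r c \<le> n" using Ple[of r c] n by (simp add: Q_def e_def)
  next
    fix r assume r: "r \<in> {1..M}"
    from rM[OF r] show "inj_on (Q r) {c \<in> {1..n}. Q r c \<noteq> 0}"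
    proof (elim disjE conjE)
      assume "r \<le> K"
      then show ?thesis using Prow[of r] r QP[of r] by simp
    next
      assume "odd n" "r = K + 1"
      then show ?thesis using Qe n by (auto simp: inj_on_def e_def)
    qed
  next
    fix r r' c assume r: "r \<in> {1..M}" "r' \<in> {1..<r}" "c \<in> {1..n}" "Q r c \<noteq> 0"
    from rM[OF r(1)] show "Q r' c \<noteq> 0 \<and> Q r' c \<noteq> Q r c"
    proof (elim disjE conjE)
      assume "r \<le> K"
      then show ?thesis using Pcol[of r r' c] r QP[of r] QP[of r'] by simp
    next
      assume o: "odd n" "r = K + 1"
      then have r': "r' \<in> {1..K}" and Qr': "Q r' = P r'" and Qr: "Q r = e"
        using r(2) QP[of r'] Qe by auto
      have "c = 1 \<or> c = n" using r(4) Qr by (auto simp: e_def split: if_splits)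
      then show ?thesis
      proof
        assume c: "c = 1"
        have "P r' 1 \<in> (\<lambda>r. P r 1) ` {1..K}" using r' by (rule imageI)
        then have "P r' 1 \<in> load n (left_start K) 1" unfolding PL1 .
        then have "P r' 1 \<noteq> 0" "P r' 1 \<le> K" unfolding load_left by simp_all
        then show ?thesis using od(1)[OF o(1)] by (simp add: Qr Qr' c e_def)
      next
        assume c: "c = n"
        have "P r' (n + 1 - 1) \<in> (\<lambda>r. P r (n + 1 - 1)) ` {1..K}" using r' by (rule imageI)
        then have "P r' (n + 1 - 1) \<in> load n (right_start n) 1" unfolding PR1 .
        then have "K < P r' n" unfolding load_right by simp
        then show ?thesis using n K4 by (simp add: Qr Qr' c e_def)
      qed
    qed
  next
    fix r x assume r: "r \<in> {1..M}" and x: "x \<in> {1..n}" and xQ: "x \<notin> Q r ` {1..n}"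
    define C where "C = {c \<in> {1..n}. Q r c \<noteq> 0 \<and> (\<forall>r'\<in>{1..<r}. Q r' c \<noteq> x)}"
    have notC: "c \<notin> C" if "r' \<in> {1..r}" "Q r' c = x" for r' c
    proof
      assume c: "c \<in> C"
      then have "r' \<noteq> r" using xQ that(2) unfolding C_def by blast
      then show False using c that by (auto simp: C_def)
    qed
    from rM[OF r] have "2 * r + card C \<le> n + 2"
    proof (elim disjE conjE)
      assume rK: "r \<le> K"
      have notCP: "c \<notin> C" if "r' \<in> {1..r}" "P r' c = x" for r' c
        using notC[of r' c] that QP[of r'] rK by simp
      \<comment> \<open>Rows 1 and 2 are completely prescribed and thus contain every
        symbol.\<close>
      have "3 \<le> r"
      proof (rule ccontr)
        assume "\<not> 3 \<le> r"
        then have "r \<in> {1, 2}" using r by auto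
        then have ne: "P r c \<noteq> 0" if "c \<in> {1..n}" for c using Pfull that by blast
        have "inj_on (P r) {c \<in> {1..n}. P r c \<noteq> 0}" using Prow[of r] r rK by simp
        moreover have "{c \<in> {1..n}. P r c \<noteq> 0} = {1..n}" using ne by auto
        ultimately have "bij_betw (P r) {1..n} {1..n}"
          using ne Ple by (intro bij_betw_self_if_inj) (simp_all add: Suc_le_eq)
        then show False using x xQ QP[OF rK] by (simp add: bij_betw_def)
      qed
      have dom: "c \<le> cut_width n r \<or> n + 1 - c \<le> cut_width n r" if "c \<in> C" for c
      proof -
        have "c \<in> {1..n}" "P r c \<noteq> 0" using that QP[OF rK] by (simp_all add: C_def)
        then show ?thesis using Pdom[of r c] \<open>3 \<le> r\<close> rK by simp
      qed
      show ?thesis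
      proof (cases "odd n \<and> r = K")
        case True
        \<comment> \<open>The exceptional row of \<open>width_plus_height_le\<close>. Its cut width
          is 2, so only four columns are prescribed, and in one of them, \<open>d\<close>, the
          symbol \<open>x\<close> already occurs. Three remain, and
          \<open>2 * K + 3 = n + 2\<close>.\<close>
        define d where "d = (if x \<le> 2 * K then left_start K x else n + 1 - right_start n x)"
        have "C \<subseteq> {1, 2, n - 1, n}"
        proof
          fix c assume c: "c \<in> C"
          then have "c \<le> 2 \<or> n + 1 - c \<le> 2" "c \<in> {1..n}"
            using dom[OF c] plannable_half(2)[OF n K_def] True by (auto simp: C_def)
          then show "c \<in> {1, 2, n - 1, n}" by auto
        qed
        moreover have "d \<notin> C"
        proof (cases "x \<le> 2 * K")
          case x2: True
          then show ?thesis using inL[OF x x2] notCP True by (auto simp: d_def)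
        next
          case False
          then have "x \<noteq> 1" using K4 by linarith
          then show ?thesis using inR[OF x] False notCP True by (auto simp: d_def)
        qed
        ultimately have "C \<subseteq> {1, 2, n - 1, n} - {d}" by blast
        moreover have "d \<in> {1, 2, n - 1, n}"
          using x by (auto simp: d_def left_start_def right_start_def Let_def K_def)
        then have "card ({1, 2, n - 1, n} - {d}) = 3" using n by (subst card_Diff_singleton) auto
        ultimately have "card C \<le> 3" using card_mono[of "{1, 2, n - 1, n} - {d}" C] by simp
        then show ?thesis using True od(1) by simp
      next
        case False
        define W where "W = row_width n r"
        have rr: "r \<in> {2..K}" using \<open>3 \<le> r\<close> rK by simp
        obtain c0 where c0: "c0 \<in> {1..W}" "c0 \<notin> C"
          using covL[OF rr x] notCP unfolding W_def by blast
        obtain c1 where c1: "c1 \<in> {1..W}" "n + 1 - c1 \<notin> C"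
          using covR[OF rr x] notCP unfolding W_def by blast
        \<comment> \<open>Both rectangles of height \<open>r\<close> contain \<open>x\<close>, which
          rules out one column on each side.\<close>
        have "C \<subseteq> ({1..W} - {c0}) \<union> (\<lambda>c. n + 1 - c) ` ({1..W} - {c1})"
        proof
          fix c assume c: "c \<in> C"
          then have cn: "c \<in> {1..n}" by (simp add: C_def)
          have "cut_width n r \<le> W" by (simp add: cut_width_def W_def)
          then consider "c \<le> W" | "n + 1 - c \<le> W" using dom[OF c] by linarith
          then show "c \<in> ({1..W} - {c0}) \<union> (\<lambda>c. n + 1 - c) ` ({1..W} - {c1})"
          proof cases
            case 1
            then show ?thesis using c c0 cn by auto
          next
            case 2
            then have "n + 1 - c \<in> {1..W} - {c1}" "c = n + 1 - (n + 1 - c)"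
              using c c1 cn by auto
            then show ?thesis by blast
          qed
        qed
        then have "card C \<le> card (({1..W} - {c0}) \<union> (\<lambda>c. n + 1 - c) ` ({1..W} - {c1}))"
          by (intro card_mono) auto
        also have "\<dots> \<le> card ({1..W} - {c0}) + card ((\<lambda>c. n + 1 - c) ` ({1..W} - {c1}))"
          by (rule card_Un_le)
        also have "card ((\<lambda>c. n + 1 - c) ` ({1..W} - {c1})) \<le> card ({1..W} - {c1})"
          by (rule card_image_le) simp
        also have "card ({1..W} - {c0}) = W - 1" using c0(1) by (simp add: card_Diff_singleton)
        also have "card ({1..W} - {c1}) = W - 1" using c1(1) by (simp add: card_Diff_singleton)
        finally have "card C \<le> 2 * (W - 1)" by simp
        moreover have "2 * r + 2 * W \<le> n + 4"
          unfolding W_def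
          by (rule width_plus_height_le) (use False \<open>3 \<le> r\<close> rK in \<open>auto simp: K_def\<close>)
        moreover have "1 \<le> W" by (simp add: W_def row_width_def)
        ultimately show ?thesis by linarith
      qed
    next
      assume o: "odd n" and rK: "r = K + 1"
      have e0: "Q r c = e c" for c using Qe[OF o] rK by simp
      have "C \<subseteq> {1, n}" using e0 by (auto simp: C_def e_def split: if_splits)
      \<comment> \<open>Only one prescribed column without \<open>x\<close> above is affordable. By
        the complementary starts, \<open>x\<close> is in column 1 if \<open>x \<le> K\<close> and in
        column \<open>n\<close> otherwise, since \<open>x\<close> is neither 1 nor
        \<open>n\<close>.\<close>
      moreover have "1 \<notin> C \<or> n \<notin> C"
      proof -
        have "Q r 1 \<in> Q r ` {1..n}" "Q r n \<in> Q r ` {1..n}" using n12(1) by simp_all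
        then have "x \<noteq> Q r 1" "x \<noteq> Q r n" using xQ by blast+
        then have "x \<noteq> n" "x \<noteq> 1" using n by (simp_all add: e0 e_def)
        then have x2: "x \<le> 2 * K" using x od(1)[OF o] by auto
        show ?thesis
        proof (cases "x \<le> K")
          case True
          then obtain r' where r': "r' \<in> {1..K}" "P r' 1 = x"
            using inL[OF x x2] by (auto simp: left_start_def)
          then show ?thesis using notC[of r' 1] QP[of r'] rK by auto
        next
          case False
          then have "right_start n x = 1" using x2 by (simp add: right_start_def K_def)
          then obtain r' where r': "r' \<in> {1..K}" "P r' n = x"
            using inR[OF x] \<open>x \<noteq> 1\<close> by auto
          then show ?thesis using notC[of r' n] QP[of r'] rK by auto
        qed
      qed
      ultimately have "C \<subseteq> {1} \<or> C \<subseteq> {n}" by blast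
      then have "card C \<le> 1" using card_mono[of "{1}" C] card_mono[of "{n}" C] by auto
      then show ?thesis using od(1)[OF o] rK by simp
    qed
    then show "2 * r + card {c \<in> {1..n}. Q r c \<noteq> 0 \<and> (\<forall>r'\<in>{1..<r}. Q r' c \<noteq> x)} \<le> n + 2"
      unfolding C_def .
  qed
  then obtain A where A: "latin_rect n M A"
    and AQ: "\<And>r c. r \<in> {1..M} \<Longrightarrow> c \<in> {1..n} \<Longrightarrow> Q r c \<noteq> 0 \<Longrightarrow> A r c = Q r c" by blast
  have KM: "K \<le> M" "1 \<le> M" using n by (auto simp: K_def M_def)
  show ?thesis
  proof (rule lrpa_of_top_half[OF n12(1) M_def A])
    fix i assume i: "i \<in> {1..M}"
    consider "i = 1" | "2 \<le> i" "i \<le> K" | "odd n" "i = K + 1" using rM[OF i] i by fastforce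
    then show "covers_corners n i A"
    proof cases
      case 1
      then show ?thesis using covers_corners_one[OF n12(1) A KM(2)] by simp
    next
      case 2
      then have i2: "i \<in> {2..K}" by simp
      show ?thesis
      proof (rule covers_corners_if_prescribed[OF n12(2) 2(1) covL[OF i2] covR[OF i2]])
        fix r c assume "r \<in> {1..i}" "c \<in> {1..n}" "P r c \<noteq> 0"
        then show "A r c = P r c" using AQ[of r c] QP[of r] 2 KM by auto
      qed
    next
      case 3
      have w: "row_width n i = 2"
      proof -
        have "(n - 1) div i = 1"
          by (rule div_nat_eqI) (use od(1)[OF 3(1)] 3(2) K4 in simp_all)
        then show ?thesis by (simp add: row_width_def)
      qed
      show ?thesis
      proof (rule covers_corners_if_prescribed[where P = Q, OF n12(2)])
        fix x assume x: "x \<in> {1..n}"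
        show "\<exists>r\<in>{1..i}. \<exists>c\<in>{1..row_width n i}. Q r c = x"
        proof (cases "x = n")
          case True
          then have "Q i 1 = x" using Qe[OF 3(1)] 3(2) by (simp add: e_def)
          then show ?thesis using w 3(2) by (intro bexI[of _ i] bexI[of _ 1]) simp_all
        next
          case False
          then have x2: "x \<le> 2 * K" using x od(1)[OF 3(1)] by auto
          obtain r where r: "r \<in> {1..K}" "P r (left_start K x) = x" using inL[OF x x2] by blast
          then show ?thesis using w 3(2) QP[of r] x2
            by (intro bexI[of _ r] bexI[of _ "left_start K x"]) (auto simp: left_start_def)
        qed
        show "\<exists>r\<in>{1..i}. \<exists>c\<in>{1..row_width n i}. Q r (n + 1 - c) = x"
        proof (cases "x = 1")
          case True
          then have "Q i (n + 1 - 1) = x" using Qe[OF 3(1)] 3(2) n by (simp add: e_def)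
          then show ?thesis using w 3(2) by (intro bexI[of _ i] bexI[of _ 1]) simp_all
        next
          case False
          obtain r where r: "r \<in> {1..K}" "P r (n + 1 - right_start n x) = x"
            using inR[OF x] False by blast
          then show ?thesis using w 3(2) QP[of r] False
            by (intro bexI[of _ r] bexI[of _ "right_start n x"])
              (auto simp: right_start_def Let_def)
        qed
      next
        show "2 \<le> i" using 3(2) K4 by simp
        show "A r c = Q r c" if "r \<in> {1..i}" "c \<in> {1..n}" "Q r c \<noteq> 0" for r c
          using AQ[of r c] that i by auto
      qed
    qed
  qed
qed

section \<open>Orders up to 7\<close>

definition array_of :: "nat list list \<Rightarrow> array" where
  "array_of xss r c = xss ! (r - 1) ! (c - 1)"

text \<open>A table lists only the top half of the rows. Images and cardinalities of explicit finite
  sets stand in for bijectivity and injectivity, so that the hypotheses can be checked by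
  evaluation.\<close>

lemma lrpa_of_table:
  assumes n: "1 \<le> n" and m: "m = (n + 1) div 2"
    and rows: "\<forall>r\<in>{1..m}. array_of xss r ` {1..n} = {1..n}"
    and cols: "\<forall>c\<in>{1..n}. card ((\<lambda>r. array_of xss r c) ` {1..m}) = m"
    and cov: "\<forall>i\<in>{1..m}. \<forall>x\<in>{1..n}.
     (\<exists>r\<in>{1..i}. \<exists>c\<in>{1..row_width n i}. array_of xss r c = x) \<and>
     (\<exists>r\<in>{1..i}. \<exists>c\<in>{1..row_width n i}. array_of xss r (n + 1 - c) = x)"
  shows "\<exists>A. lrpa_type12 n A"
proof (rule lrpa_of_top_half[OF n m])
  show "latin_rect n m (array_of xss)"
    unfolding latin_rect_def
  proof (intro conjI ballI)
    show "bij_betw (array_of xss r) {1..n} {1..n}" if "r \<in> {1..m}" for r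
      using bspec[OF rows that] by (intro bij_betw_imageI eq_card_imp_inj_on) simp_all
    show "inj_on (\<lambda>r. array_of xss r c) {1..m}" if "c \<in> {1..n}" for c
      by (rule eq_card_imp_inj_on, simp, subst bspec[OF cols that], simp)
  qed
  show "covers_corners n i (array_of xss)" if "i \<in> {1..m}" for i
    unfolding covers_corners_def by (rule bspec[OF cov that])
qed

lemma Icc_numeral: "{Suc 0..numeral k} = insert (numeral k) {Suc 0..pred_numeral k}"
  by (auto simp: numeral_eq_Suc)

lemma ex_lrpa_le_7:
  assumes "1 \<le> n" "n \<le> 7"
  shows "\<exists>A. lrpa_type12 n A"
proof -
  note table_simps = array_of_def row_width_def Icc_numeral atLeastAtMostSuc_conv insert_commute
  have "\<exists>A. lrpa_type12 1 A"
    by (rule lrpa_of_table[where xss = "[[1]]", OF _ refl]) (simp_all add: table_simps)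
  moreover have "\<exists>A. lrpa_type12 2 A"
    by (rule lrpa_of_table[where xss = "[[1, 2]]", OF _ refl]) (simp_all add: table_simps)
  moreover have "\<exists>A. lrpa_type12 3 A"
    by (rule lrpa_of_table[where xss = "[[1, 2, 3], [2, 3, 1]]", OF _ refl])
      (simp_all add: table_simps)
  moreover have "\<exists>A. lrpa_type12 4 A"
    by (rule lrpa_of_table[where xss = "[[1, 2, 3, 4], [3, 4, 1, 2]]", OF _ refl])
      (simp_all add: table_simps)
  moreover have "\<exists>A. lrpa_type12 5 A"
    by (rule lrpa_of_table[where xss =
          "[[1, 2, 3, 4, 5], [3, 4, 5, 1, 2], [2, 5, 1, 3, 4]]", OF _ refl])
      (simp_all add: table_simps)
  moreover have "\<exists>A. lrpa_type12 6 A"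
    by (rule lrpa_of_table[where xss =
          "[[1, 2, 3, 4, 5, 6], [4, 5, 6, 1, 2, 3], [3, 6, 2, 5, 1, 4]]", OF _ refl])
      (simp_all add: table_simps)
  moreover have "\<exists>A. lrpa_type12 7 A"
    by (rule lrpa_of_table[where xss = "[[1, 2, 3, 4, 5, 6, 7], [4, 5, 6, 7, 1, 2, 3],
          [2, 3, 7, 1, 4, 5, 6], [6, 7, 2, 5, 3, 1, 4]]", OF _ refl])
      (simp_all add: table_simps)
  moreover have "n \<in> {1, 2, 3, 4, 5, 6, 7}" using assms by auto
  ultimately show ?thesis by blast
qed

theorem theorem3p4:
  fixes n :: nat
  assumes "n \<ge> 1"
  shows "\<exists>A. lrpa_type12 n A"
  using ex_lrpa_le_7[OF assms] ex_lrpa_ge_8[of n] by (cases "n \<le> 7") simp_all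

end
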